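(* Let $a>0$ and let $q:\mathbb{R}\to\mathbb{R}$ be a real potential with $\int_{\mathbb{R}}|q(x)|^2e^{2a|x|}\,dx<\infty$. Let $\Omega_0^-=\{\lambda=\alpha+i\beta:\ \alpha,\beta\in\mathbb{R},\ |\alpha|<-\sqrt3\,\beta\}$, let $\varphi_0(\lambda,x)$ be the solution of the integral equation $$\varphi_0(\lambda,x)=1+i\int_{-\infty}^x e^{i\lambda\zeta_0(t-x)}\frac{s_2(i\lambda(x-t))}{(i\lambda)^2}q(t)\varphi_0(\lambda,t)\,dt ,$$ and let $u_0(\lambda,x)=\varphi_0(\lambda,x)e^{i\lambda\zeta_0x}$. Then for all $x\in\mathbb{R}$ the function $\varphi_0(\lambda,x)$ is holomorphic in $\lambda$ in the sector $\Omega_0^-$, and for $\lambda\in\Omega_0^-$ with $|\lambda|\gg1$, so large that $r(\lambda)<1$, (a) $\varphi_0(\lambda,x)=1-\dfrac{i}{3\lambda^2}\displaystyle\int_{-\infty}^x q(t)\,dt+\widehat C_0(\lambda,x)+\widehat D_0(\lambda,x)$; (b) $u_0'(\lambda,x)e^{-i\lambda\zeta_0x}=i\lambda\zeta_0+\dfrac1{3\lambda}\displaystyle\int_{-\infty}^x q(t)\,dt+\widehat C_1(\lambda,x)+\widehat D_1(\lambda,x)$; (c) $u_0''(\lambda,x)e^{-i\lambda\zeta_0x}=(i\lambda\zeta_0)^2+\dfrac i3\displaystyle\int_{-\infty}^x q(t)\,dt+\widehat C_2(\lambda,x)+\widehat D_2(\lambda,x)$, where the functions $\widehat C_k,\widehat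 D_k$ ($0\le k\le 2$) satisfy $$|\widehat C_k(\lambda,x)|<|\lambda|^k\,r(\lambda)(1-r(\lambda))^{-1},\qquad |\widehat D_k(\lambda,x)|<q_2|\lambda|^{k-2}\widehat\delta(\lambda).$$ Here $r(\lambda)=q_1/|\lambda|^2$, $q_s=\|q\|_{L^s(\mathbb{R})}$ ($s=1,2$), and $\widehat\delta(\lambda)=(-\beta\sqrt3-|\alpha|)^{-1/2}$ for $\lambda=\alpha+i\beta\in\Omega_0^-$.
   Context: Primes on $u_0$ denote derivatives in $x$. $\zeta_0=1$, $\zeta_1=\frac12(-1+i\sqrt3)$, $\zeta_2=\frac12(-1-i\sqrt3)$ are the cube roots of unity and $s_2(z)=\frac13\sum_{k=0}^2\zeta_k^{-2}e^{\zeta_kz}$. The solution $\varphi_0$ is the one obtained by successive approximations. The condition on $q$ implies $q\in L^1(\mathbb{R})\cap L^2(\mathbb{R})$. The function $u_0$ is a Jost solution of $iy'''+qy=\lambda^3y$. The $\widehat C_k,\widehat D_k$ are remainder functions for which the expansions and estimates hold.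
   Formalization: If q = 0 almost everywhere, the strict bounds on the remainders would read |C_k| < 0 and |D_k| < 0, which is impossible; the strict bounds are therefore stated for q not almost everywhere zero, and the non-strict bounds for every q. *)

theory Defs
  imports "HOL-Complex_Analysis.Complex_Analysis"
begin

text \<open>Throughout, functions on the line are Lebesgue measurable and integrals are Lebesgue
  integrals with respect to \<^const>\<open>lebesgue\<close>; the spectral parameter is written \<open>l\<close>.\<close>

definition zeta :: "nat \<Rightarrow> complex" where
  "zeta k = (if k = 0 then 1
             else if k = 1 then (-1 + \<i> * complex_of_real (sqrt 3)) / 2
             else (-1 - \<i> * complex_of_real (sqrt 3)) / 2)"

definition s2 :: "complex \<Rightarrow> complex" where
  "s2 z = (1/3) * (\<Sum>k=0..2. zeta k powi (-2) * exp (zeta k * z))"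

definition Omega0_minus :: "complex set" where
  "Omega0_minus = {l. \<bar>Re l\<bar> < - (sqrt 3 * Im l)}"

definition phi0_integrand :: "(real \<Rightarrow> real) \<Rightarrow> complex \<Rightarrow> (real \<Rightarrow> complex) \<Rightarrow> real \<Rightarrow> real \<Rightarrow> complex" where
  "phi0_integrand q l f x t =
     exp (\<i> * l * zeta 0 * complex_of_real (t - x))
     * (s2 (\<i> * l * complex_of_real (x - t)) / (\<i> * l)^2)
     * complex_of_real (q t) * f t"

definition phi0_map :: "(real \<Rightarrow> real) \<Rightarrow> complex \<Rightarrow> (real \<Rightarrow> complex) \<Rightarrow> real \<Rightarrow> complex" where
  "phi0_map q l f x = 1 + \<i> * (LINT t:{..x}|lebesgue. phi0_integrand q l f x t)"

text \<open>The integrability clause excludes functions for which the integral would only have its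
  default value.\<close>

definition solves_phi0_equation :: "(real \<Rightarrow> real) \<Rightarrow> complex \<Rightarrow> (real \<Rightarrow> complex) \<Rightarrow> bool" where
  "solves_phi0_equation q l f \<longleftrightarrow>
     (\<forall>x. set_integrable lebesgue {..x} (phi0_integrand q l f x) \<and> f x = phi0_map q l f x)"

definition phi0_approx :: "(real \<Rightarrow> real) \<Rightarrow> complex \<Rightarrow> nat \<Rightarrow> real \<Rightarrow> complex" where
  "phi0_approx q l n = (phi0_map q l ^^ n) (\<lambda>_. 1)"

text \<open>The solution obtained by successive approximations.\<close>

definition phi0 :: "(real \<Rightarrow> real) \<Rightarrow> complex \<Rightarrow> real \<Rightarrow> complex" where
  "phi0 q l x = lim (\<lambda>n. phi0_approx q l n x)"

definition u0 :: "(real \<Rightarrow> real) \<Rightarrow> complex \<Rightarrow> real \<Rightarrow> complex" where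
  "u0 q l x = phi0 q l x * exp (\<i> * l * zeta 0 * complex_of_real x)"

definition Lnorm :: "real \<Rightarrow> (real \<Rightarrow> real) \<Rightarrow> real" where
  "Lnorm s q = (LINT x|lebesgue. \<bar>q x\<bar> powr s) powr (1 / s)"

definition rr :: "(real \<Rightarrow> real) \<Rightarrow> complex \<Rightarrow> real" where
  "rr q l = Lnorm 1 q / (norm l)^2"

definition delta_hat :: "complex \<Rightarrow> real" where
  "delta_hat l = (- (Im l * sqrt 3) - \<bar>Re l\<bar>) powr (-1/2)"

end

theory Submission
  imports Defs
begin

text \<open>For \<open>l\<close> in the sector, the exponentials \<open>exp (\<i> * l * (zeta k - 1) * s)\<close>, \<open>s \<ge> 0\<close>, are bounded for
  \<open>k = 0\<close> and decay at rate at least \<open>sqrt 3 / 2 * (- (Im l * sqrt 3) - \<bar>Re l\<bar>)\<close> for \<open>k = 1, 2\<close>. Hence the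
  integral equation is a Volterra equation with a bounded kernel. Its operator contracts by the factor
  \<open>1/2\<close> in a suitably weighted sup norm, locally uniformly in \<open>l\<close>, which gives convergence and
  holomorphy. The sum of the three exponentials with coefficients \<open>zeta k ^ (j + 1)\<close> vanishes at
  \<open>s = 0\<close> for \<open>j < 2\<close>, so the kernel extended by zero is Lipschitz and the solution can be differentiated
  twice under the integral although \<open>q\<close> is only integrable. In the resulting formulas, the exponential
  with \<open>k = 0\<close> applied to \<open>q\<close> alone gives the main term, those with \<open>k = 1, 2\<close> give \<open>D\<close> by Cauchy-Schwarz,
  and the part with \<open>q * (phi0 - 1)\<close> gives \<open>C\<close>, where \<open>\<bar>phi0 - 1\<bar> \<le> r / (1 - r)\<close>.\<close>

section \<open>Integrals depending on a parameter\<close>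

text \<open>In a first countable space a limit at \<open>z\<close> can be tested along sequences in
  \<open>S - {z}\<close>, and along each of them ordinary dominated convergence applies. The point
  \<open>z\<close> is left out so that difference quotients may be inserted for
  \<open>f\<close>.\<close>

lemma integral_dominated_convergence_at:
  fixes f :: "'c::first_countable_topology \<Rightarrow> 'a \<Rightarrow> 'b::{banach, second_countable_topology}"
  assumes g: "g \<in> borel_measurable M"
    and f: "\<And>y. y \<in> S \<Longrightarrow> y \<noteq> z \<Longrightarrow> f y \<in> borel_measurable M"
    and S: "open S" "z \<in> S"
    and h: "integrable M h"
    and lim: "AE t in M. ((\<lambda>y. f y t) \<longlongrightarrow> g t) (at z)"
    and bound: "\<And>y t. y \<in> S \<Longrightarrow> y \<noteq> z \<Longrightarrow> t \<in> space M \<Longrightarrow> norm (f y t) \<le> h t"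
  shows "((\<lambda>y. \<integral>t. f y t \<partial>M) \<longlongrightarrow> (\<integral>t. g t \<partial>M)) (at z)"
proof -
  have "(\<lambda>n. \<integral>t. f (X n) t \<partial>M) \<longlonglongrightarrow> (\<integral>t. g t \<partial>M)"
    if X: "\<And>n. X n \<in> S - {z}" "X \<longlonglongrightarrow> z" for X
  proof (rule integral_dominated_convergence[OF g _ h])
    show "AE t in M. (\<lambda>n. f (X n) t) \<longlonglongrightarrow> g t"
      using lim
    proof eventually_elim
      case (elim t)
      then show ?case
        using X unfolding tendsto_at_iff_sequentially o_def by blast
    qed
    have X': "X n \<in> S" "X n \<noteq> z" for n
      using X(1)[of n] by auto
    show "f (X n) \<in> borel_measurable M" for n
      using X' by (rule f)
    show "AE t in M. norm (f (X n) t) \<le> h t" for n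
      by (rule AE_I2) (rule bound[OF X'])
  qed
  then have "((\<lambda>y. \<integral>t. f y t \<partial>M) \<longlongrightarrow> (\<integral>t. g t \<partial>M)) (at z within S)"
    unfolding tendsto_at_iff_sequentially o_def by blast
  then show ?thesis
    by (simp only: at_within_open[OF S(2,1)])
qed

text \<open>The derivative is the pointwise limit of difference quotients along one sequence that
  serves all \<open>t\<close>, so it inherits their measurability.\<close>

lemma borel_measurable_deriv:
  fixes f :: "complex \<Rightarrow> 'a \<Rightarrow> complex"
  assumes S: "open S" "z \<in> S"
    and meas: "\<And>w. w \<in> S \<Longrightarrow> f w \<in> borel_measurable M"
    and d: "\<And>t. t \<in> space M \<Longrightarrow> ((\<lambda>w. f w t) has_field_derivative f' t) (at z)"
  shows "f' \<in> borel_measurable M"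
proof -
  obtain e where e: "e > 0" "ball z e \<subseteq> S"
    using S open_contains_ball by metis
  \<comment> \<open>The increments are positive and at most \<open>e / 2\<close>, so every
    \<open>X n\<close> lies in the ball and differs from \<open>z\<close>.\<close>
  define X where "X n = z + of_real (e / 2 / of_nat (Suc n))" for n
  have X: "X n \<in> S" "X n \<noteq> z" for n
  proof -
    have "e / 2 / (1 + real n) < e"
      using e by (auto simp: field_simps intro: add_pos_nonneg)
    then show "X n \<in> S" "X n \<noteq> z"
      using e by (auto simp: X_def dist_norm simp del: of_real_divide intro!: subsetD[OF e(2)])
  qed
  have "(\<lambda>n. e / 2 / of_nat (Suc n)) \<longlonglongrightarrow> 0"
    by real_asymp
  then have "X \<longlonglongrightarrow> z + of_real 0"
    unfolding X_def by (intro tendsto_intros)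
  then have X_lim: "filterlim X (at z) sequentially"
    using X by (simp add: filterlim_at)
  show ?thesis
  proof (rule borel_measurable_LIMSEQ_metric)
    show "(\<lambda>t. (f (X n) t - f z t) / (X n - z)) \<in> borel_measurable M" for n
      using meas[OF X(1)] meas[OF S(2)] by measurable
    show "(\<lambda>n. (f (X n) t - f z t) / (X n - z)) \<longlonglongrightarrow> f' t" if "t \<in> space M" for t
      using filterlim_compose[OF d[OF that, unfolded has_field_derivative_iff] X_lim] .
  qed
qed

text \<open>No majorant of the derivative has to be supplied: Cauchy's inequality on discs of a
  fixed radius turns the bound \<open>h t\<close> into \<open>h t / d\<close> for the derivative,
  and the mean value inequality passes this on to the difference quotients.\<close>

lemma holomorphic_on_integral:
  fixes f :: "complex \<Rightarrow> 'a \<Rightarrow> complex"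
  assumes S: "open S"
    and hol: "\<And>t. t \<in> space M \<Longrightarrow> (\<lambda>z. f z t) holomorphic_on S"
    and meas: "\<And>z. z \<in> S \<Longrightarrow> f z \<in> borel_measurable M"
    and bound: "\<And>z t. z \<in> S \<Longrightarrow> t \<in> space M \<Longrightarrow> norm (f z t) \<le> h t"
    and h: "integrable M h"
  shows "(\<lambda>z. \<integral>t. f z t \<partial>M) holomorphic_on S"
proof -
  have "((\<lambda>z. \<integral>t. f z t \<partial>M) has_field_derivative (\<integral>t. deriv (\<lambda>z. f z t) z \<partial>M)) (at z)"
    if z: "z \<in> S" for z
  proof -
    obtain e where e: "e > 0" "ball z e \<subseteq> S"
      using S z open_contains_ball by metis
    \<comment> \<open>A closed disc of radius \<open>e / 3\<close> about a point closer than
      \<open>e / 3\<close> to \<open>z\<close> stays closer than \<open>e\<close> to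
      \<open>z\<close>, hence inside \<open>S\<close>.\<close>
    define d where "d = e / 3"
    have d: "d > 0" "cball w d \<subseteq> S" if "dist z w < d" for w
    proof -
      show "d > 0" using e by (simp add: d_def)
      show "cball w d \<subseteq> S"
      proof
        fix y assume "y \<in> cball w d"
        then have "dist z y < e"
          using that dist_triangle[of z y w] e by (simp add: d_def)
        then show "y \<in> S" using e by auto
      qed
    qed
    have d0: "d > 0" using e by (simp add: d_def)
    have int: "integrable M (f w)" if "w \<in> S" for w
      by (rule Bochner_Integration.integrable_bound[OF h meas[OF that]])
        (use bound that in \<open>auto intro!: AE_I2 order_trans[OF bound[OF that]]\<close>)
    have der: "((\<lambda>z. f z t) has_field_derivative deriv (\<lambda>z. f z t) w) (at w)"
      if "t \<in> space M" "w \<in> S" for t w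
      using holomorphic_derivI[OF hol S] that by blast
    have derb: "norm (deriv (\<lambda>z. f z t) w) \<le> h t / d" if t: "t \<in> space M" and w: "dist z w < d" for t w
    proof -
      have "norm ((deriv ^^ 1) (\<lambda>z. f z t) w) \<le> fact 1 * h t / d ^ 1"
      proof (rule Cauchy_inequality)
        show "(\<lambda>z. f z t) holomorphic_on ball w d"
          by (rule holomorphic_on_subset[OF hol[OF t]])
            (use d(2)[OF w] ball_subset_cball in blast)
        show "continuous_on (cball w d) (\<lambda>z. f z t)"
          by (rule continuous_on_subset[OF holomorphic_on_imp_continuous_on[OF hol[OF t]]])
            (use d(2)[OF w] in blast)
        show "norm (f x t) \<le> h t" if "norm (w - x) = d" for x
          by (rule bound) (use d(2)[OF w] that t in \<open>auto simp: dist_norm subset_iff\<close>)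
      qed (use d0 in auto)
      then show ?thesis by simp
    qed
    have "((\<lambda>y. \<integral>t. (f y t - f z t) / (y - z) \<partial>M) \<longlongrightarrow> (\<integral>t. deriv (\<lambda>z. f z t) z \<partial>M)) (at z)"
    proof (rule integral_dominated_convergence_at[where S = "ball z d" and h = "\<lambda>t. h t / d"])
      show "(\<lambda>t. deriv (\<lambda>z. f z t) z) \<in> borel_measurable M"
        by (rule borel_measurable_deriv[OF S z meas der]) (use z in auto)
      show "(\<lambda>t. (f y t - f z t) / (y - z)) \<in> borel_measurable M" if "y \<in> ball z d" for y
      proof -
        have "y \<in> S" using that e by (auto simp: d_def)
        note [measurable] = meas[OF this] meas[OF z]
        show ?thesis by measurable
      qed
      show "AE t in M. ((\<lambda>y. (f y t - f z t) / (y - z)) \<longlongrightarrow> deriv (\<lambda>z. f z t) z) (at z)"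
        using der z by (intro AE_I2) (simp add: has_field_derivative_iff)
      show "norm ((f y t - f z t) / (y - z)) \<le> h t / d"
        if y: "y \<in> ball z d" "y \<noteq> z" and t: "t \<in> space M" for y t
      proof -
        have "norm (f y t - f z t) \<le> h t / d * norm (y - z)"
        proof (rule field_differentiable_bound[where S = "ball z d" and f' = "deriv (\<lambda>z. f z t)"])
          fix w assume w: "w \<in> ball z d"
          then have "w \<in> S" using e by (auto simp: d_def)
          then show "((\<lambda>z. f z t) has_field_derivative deriv (\<lambda>z. f z t) w) (at w within ball z d)"
            using der[OF t] has_field_derivative_at_within by blast
          show "norm (deriv (\<lambda>z. f z t) w) \<le> h t / d"
            using derb[OF t] w by simp
        qed (use y d0 in auto)
        then show ?thesis
          using y d0 by (simp add: norm_divide pos_divide_le_eq)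
      qed
    qed (use d0 h in auto)
    moreover have "\<forall>\<^sub>F y in at z. (\<integral>t. (f y t - f z t) / (y - z) \<partial>M) = ((\<integral>t. f y t \<partial>M) - (\<integral>t. f z t \<partial>M)) / (y - z)"
      unfolding eventually_at_topological using S z int by (intro exI[of _ S]) auto
    ultimately show ?thesis
      unfolding has_field_derivative_iff by (rule Lim_transform_eventually)
  qed
  then show ?thesis
    using S by (auto simp: holomorphic_on_open)
qed

section \<open>Cauchy-Schwarz and exponential integrals over a half-line\<close>

text \<open>The inequality is the one for nonnegative extended integrals. The bound of
  \<open>\<bar>f x * g x\<bar>\<close> by the sum of the squares gives the integrability needed to
  return to Bochner integrals.\<close>

lemma integral_abs_mult_Cauchy_Schwarz:
  fixes f g :: "'a \<Rightarrow> real"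
  assumes [measurable]: "f \<in> borel_measurable M" "g \<in> borel_measurable M"
    and f: "integrable M (\<lambda>x. (f x)\<^sup>2)" and g: "integrable M (\<lambda>x. (g x)\<^sup>2)"
  shows "integrable M (\<lambda>x. \<bar>f x * g x\<bar>)"
    and "(\<integral>x. \<bar>f x * g x\<bar> \<partial>M) \<le> sqrt (\<integral>x. (f x)\<^sup>2 \<partial>M) * sqrt (\<integral>x. (g x)\<^sup>2 \<partial>M)"
proof -
  have b: "\<bar>f x * g x\<bar> \<le> (f x)\<^sup>2 + (g x)\<^sup>2" for x
  proof -
    have "2 * (\<bar>f x\<bar> * \<bar>g x\<bar>) \<le> (f x)\<^sup>2 + (g x)\<^sup>2" "0 \<le> \<bar>f x\<bar> * \<bar>g x\<bar>"
      using sum_squares_bound[of "\<bar>f x\<bar>" "\<bar>g x\<bar>"] by (simp_all add: mult.assoc)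
    then show ?thesis
      unfolding abs_mult by linarith
  qed
  show i: "integrable M (\<lambda>x. \<bar>f x * g x\<bar>)"
    by (rule Bochner_Integration.integrable_bound[OF Bochner_Integration.integrable_add[OF f g]]) (use b in auto)
  have "(\<integral>\<^sup>+x. ennreal \<bar>f x\<bar> * ennreal \<bar>g x\<bar> \<partial>M)\<^sup>2 \<le> (\<integral>\<^sup>+x. (ennreal \<bar>f x\<bar>)\<^sup>2 \<partial>M) * (\<integral>\<^sup>+x. (ennreal \<bar>g x\<bar>)\<^sup>2 \<partial>M)"
    by (rule Cauchy_Schwarz_nn_integral) auto
  then have "(\<integral>\<^sup>+x. ennreal \<bar>f x * g x\<bar> \<partial>M)\<^sup>2 \<le> (\<integral>\<^sup>+x. ennreal ((f x)\<^sup>2) \<partial>M) * (\<integral>\<^sup>+x. ennreal ((g x)\<^sup>2) \<partial>M)"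
    by (simp add: ennreal_mult' ennreal_power abs_mult)
  then have "ennreal ((\<integral>x. \<bar>f x * g x\<bar> \<partial>M)\<^sup>2) \<le> ennreal ((\<integral>x. (f x)\<^sup>2 \<partial>M) * (\<integral>x. (g x)\<^sup>2 \<partial>M))"
    using f g i by (simp add: nn_integral_eq_integral ennreal_power ennreal_mult')
  then have "(\<integral>x. \<bar>f x * g x\<bar> \<partial>M)\<^sup>2 \<le> (\<integral>x. (f x)\<^sup>2 \<partial>M) * (\<integral>x. (g x)\<^sup>2 \<partial>M)"
    by (subst (asm) ennreal_le_iff) auto
  then show "(\<integral>x. \<bar>f x * g x\<bar> \<partial>M) \<le> sqrt (\<integral>x. (f x)\<^sup>2 \<partial>M) * sqrt (\<integral>x. (g x)\<^sup>2 \<partial>M)"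
    by (simp add: real_le_rsqrt flip: real_sqrt_mult)
qed

lemma exp_integral_atMost:
  fixes c x :: real
  assumes "c > 0"
  shows "integrable lebesgue (\<lambda>t. indicator {..x} t * exp (c * (t - x)))"
    and "(\<integral>t. indicator {..x} t * exp (c * (t - x)) \<partial>lebesgue) = 1 / c"
proof -
  have "(\<lambda>t. exp (- c * t)) absolutely_integrable_on {0..}"
    using integrable_on_exp_minus_to_infinity[OF assms] by (intro nonnegative_absolutely_integrable_1) auto
  moreover from set_lebesgue_integral_eq_integral(2)[OF this]
  have "(LINT t:{0..}|lebesgue. exp (- c * t)) = 1 / c"
    using has_integral_exp_minus_to_infinity[OF assms, of 0] by (auto simp: integral_unique)
  ultimately have "has_bochner_integral lebesgue (\<lambda>t. indicator {0..} t *\<^sub>R exp (- c * t)) (1 / c)"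
    unfolding has_bochner_integral_iff set_integrable_def set_lebesgue_integral_def by blast
  \<comment> \<open>The reflection of \<open>t\<close> to \<open>x - t\<close> carries
    \<open>{..x}\<close> to \<open>{0..}\<close> and preserves the measure.\<close>
  then have "has_bochner_integral lebesgue (\<lambda>t. indicator {0..} (x + (-1) * t) *\<^sub>R exp (- c * (x + (-1) * t))) (1 / c / \<bar>-1\<bar>)"
    by (subst (asm) has_bochner_integral_lebesgue_real_affine_iff[of "-1" _ _ x]) auto
  moreover have "indicator {0..} (x + (-1) * t) *\<^sub>R exp (- c * (x + (-1) * t)) = indicator {..x} t * exp (c * (t - x))" for t
    by (auto simp: indicator_def algebra_simps)
  ultimately have "has_bochner_integral lebesgue (\<lambda>t. indicator {..x} t * exp (c * (t - x))) (1 / c)"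
    by simp
  then show "integrable lebesgue (\<lambda>t. indicator {..x} t * exp (c * (t - x)))"
    "(\<integral>t. indicator {..x} t * exp (c * (t - x)) \<partial>lebesgue) = 1 / c"
    by (auto simp: has_bochner_integral_iff)
qed

section \<open>The kernels\<close>

lemma zeta_0 [simp]: "zeta 0 = 1"
  by (simp add: zeta_def)

lemma zeta_1: "zeta (Suc 0) = Complex (-1/2) (sqrt 3 / 2)"
  by (simp add: zeta_def complex_eq_iff)

lemma zeta_2: "zeta 2 = Complex (-1/2) (- sqrt 3 / 2)"
  by (simp add: zeta_def complex_eq_iff)

lemma zeta_1_power2: "zeta (Suc 0) ^ 2 = zeta 2"
  by (simp add: zeta_1 zeta_2 complex_eq_iff power2_eq_square)

lemma zeta_2_power2: "zeta 2 ^ 2 = zeta (Suc 0)"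
  by (simp add: zeta_1 zeta_2 complex_eq_iff power2_eq_square)

lemma zeta_1_mult_2: "zeta (Suc 0) * zeta 2 = 1"
  by (simp add: zeta_1 zeta_2 complex_eq_iff)

lemma zeta_sum: "1 + zeta (Suc 0) + zeta 2 = 0"
  by (simp add: zeta_1 zeta_2 complex_eq_iff)

lemma norm_zeta: "norm (zeta k) = 1"
  by (simp add: zeta_def cmod_def power_divide)

text \<open>Since \<open>zeta k\<close> is a cube root of unity, the exponents \<open>-2\<close> and
  \<open>1\<close> give the same power. This simplifies the coefficients of
  \<open>s2\<close>.\<close>

lemma zeta_powi: "k \<le> 2 \<Longrightarrow> zeta k powi (-2) = zeta k"
proof -
  assume "k \<le> 2"
  then consider "k = 0" | "k = Suc 0" | "k = 2" by linarith
  then have "zeta k ^ 2 * zeta k = 1"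
    by cases (simp_all add: zeta_1_power2 zeta_2_power2 zeta_1_mult_2 mult.commute)
  then have "inverse (zeta k ^ 2) = zeta k"
    by (rule inverse_unique)
  then show ?thesis
    by (simp add: power_int_minus)
qed

lemma Omega0_minus_nonzero: "l \<in> Omega0_minus \<Longrightarrow> l \<noteq> 0"
  by (auto simp: Omega0_minus_def)

lemma open_Omega0_minus: "open Omega0_minus"
  unfolding Omega0_minus_def by (intro open_Collect_less continuous_intros)

text \<open>Both differences \<open>zeta k - 1\<close> have real part \<open>-3/2\<close> and
  imaginary part of modulus \<open>sqrt 3 / 2\<close>. The sector is exactly where both exponents
  have negative real part.\<close>

lemma Re_exponent_le:
  assumes "k = Suc 0 \<or> k = 2"
  shows "Re (\<i> * l * (zeta k - 1)) \<le> - (sqrt 3 / 2 * (- (Im l * sqrt 3) - \<bar>Re l\<bar>))"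
proof -
  have "Re (\<i> * l * (zeta k - 1)) = 3 / 2 * Im l - sqrt 3 / 2 * (if k = 2 then - Re l else Re l)"
    using assms by (auto simp: zeta_1 zeta_2 algebra_simps)
  also have "\<dots> \<le> 3 / 2 * Im l + sqrt 3 / 2 * \<bar>Re l\<bar>"
  proof -
    have "sqrt 3 / 2 * - (if k = 2 then - Re l else Re l) \<le> sqrt 3 / 2 * \<bar>Re l\<bar>"
      by (intro mult_left_mono) auto
    then show ?thesis by (simp only: mult_minus_right)
  qed
  also have "\<dots> = - (sqrt 3 / 2 * (- (Im l * sqrt 3) - \<bar>Re l\<bar>))"
    by (simp add: algebra_simps)
  finally show ?thesis .
qed

text \<open>The coefficients \<open>zeta k powi (-2)\<close> of \<open>s2\<close> equal
  \<open>zeta k\<close>, and each derivative of \<open>u0\<close> contributes one more factor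
  \<open>zeta k\<close>; this explains the exponent \<open>Suc j\<close>. Subtracting
  \<open>1\<close> from \<open>zeta k\<close> accounts for the factor
  \<open>exp (\<i> * l * x)\<close> split off from \<open>u0\<close>, and makes the summand for
  \<open>k = 0\<close> constant.\<close>

definition expsum :: "complex \<Rightarrow> nat \<Rightarrow> real \<Rightarrow> complex" where
  "expsum l j s = (\<Sum>k\<le>2. zeta k ^ Suc j * exp (\<i> * l * (zeta k - 1) * of_real s))"

text \<open>Up to constants, the convolution kernel of the integral equation (\<open>j = 0\<close>) and of the formulas
  for the first two derivatives of \<open>u0\<close> (\<open>j = 1, 2\<close>).\<close>
definition kern :: "complex \<Rightarrow> nat \<Rightarrow> real \<Rightarrow> complex" where
  "kern l j s = (if s < 0 then 0 else expsum l j s)"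

lemma expsum_eq:
  "expsum l j s = 1 + zeta (Suc 0) ^ Suc j * exp (\<i> * l * (zeta (Suc 0) - 1) * of_real s)
     + zeta 2 ^ Suc j * exp (\<i> * l * (zeta 2 - 1) * of_real s)"
  unfolding expsum_def numeral_2_eq_2 by (simp add: atMost_Suc add_ac)

lemma norm_exp_decay:
  assumes "k = Suc 0 \<or> k = 2" "s \<ge> 0"
  shows "norm (exp (\<i> * l * (zeta k - 1) * of_real s))
    \<le> exp (- (sqrt 3 / 2 * (- (Im l * sqrt 3) - \<bar>Re l\<bar>)) * s)"
proof -
  have "Re (\<i> * l * (zeta k - 1) * of_real s) = Re (\<i> * l * (zeta k - 1)) * s"
    by simp
  also have "\<dots> \<le> - (sqrt 3 / 2 * (- (Im l * sqrt 3) - \<bar>Re l\<bar>)) * s"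
    using assms Re_exponent_le by (intro mult_right_mono) auto
  finally show ?thesis
    unfolding norm_exp_eq_Re by simp
qed

lemma norm_expsum_minus_1:
  assumes "s \<ge> 0"
  shows "norm (expsum l j s - 1) \<le> 2 * exp (- (sqrt 3 / 2 * (- (Im l * sqrt 3) - \<bar>Re l\<bar>)) * s)"
proof -
  have "norm (expsum l j s - 1) \<le> norm (exp (\<i> * l * (zeta (Suc 0) - 1) * of_real s))
      + norm (exp (\<i> * l * (zeta 2 - 1) * of_real s))"
    using norm_triangle_ineq[of "zeta (Suc 0) ^ Suc j * exp (\<i> * l * (zeta (Suc 0) - 1) * of_real s)"
        "zeta 2 ^ Suc j * exp (\<i> * l * (zeta 2 - 1) * of_real s)"]
    unfolding expsum_eq norm_mult norm_power norm_zeta by (simp add: add.assoc)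
  then show ?thesis
    using norm_exp_decay[of "Suc 0" s l] norm_exp_decay[of 2 s l] assms by linarith
qed

lemma norm_expsum_le:
  assumes "l \<in> Omega0_minus" "s \<ge> 0"
  shows "norm (expsum l j s) \<le> 3"
proof -
  have "exp (- (sqrt 3 / 2 * (- (Im l * sqrt 3) - \<bar>Re l\<bar>)) * s) \<le> 1"
    using assms by (simp add: Omega0_minus_def mult.commute)
  moreover have "norm (expsum l j s) \<le> 1 + norm (expsum l j s - 1)"
    using norm_triangle_ineq[of 1 "expsum l j s - 1"] by simp
  ultimately show ?thesis
    using norm_expsum_minus_1[OF assms(2), of l j] by linarith
qed

lemma norm_kern_le: "l \<in> Omega0_minus \<Longrightarrow> norm (kern l j s) \<le> 3"
  by (simp add: kern_def norm_expsum_le)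

lemma borel_measurable_kern: "(\<lambda>t. kern l j (x - t)) \<in> borel_measurable lebesgue"
proof -
  have "(\<lambda>t. kern l j (x - t)) \<in> borel_measurable borel"
    unfolding kern_def expsum_def by measurable
  then show ?thesis
    by (simp add: measurable_completion)
qed

text \<open>Each exponential brings down a factor \<open>zeta k - 1\<close>, which splits its
  coefficient into those of index \<open>Suc j\<close> and \<open>j\<close>; the family is thus
  closed under differentiation.\<close>

lemma expsum_has_vector_derivative:
  "(expsum l j has_vector_derivative \<i> * l * (expsum l (Suc j) s - expsum l j s)) (at s within S)"
proof -
  have "((\<lambda>s. \<Sum>k\<le>2. zeta k ^ Suc j * exp (\<i> * l * (zeta k - 1) * of_real s)) has_vector_derivative
      (\<Sum>k\<le>2. zeta k ^ Suc j * (exp (\<i> * l * (zeta k - 1) * of_real s) * (\<i> * l * (zeta k - 1))))) (at s within S)"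
  proof (intro has_vector_derivative_sum has_vector_derivative_mult_right)
    fix k
    have "((\<lambda>z. exp (\<i> * l * (zeta k - 1) * z)) has_field_derivative
        exp (\<i> * l * (zeta k - 1) * of_real s) * (\<i> * l * (zeta k - 1))) (at (of_real s) within of_real ` S)"
      by (auto intro!: derivative_eq_intros)
    then show "((\<lambda>s. exp (\<i> * l * (zeta k - 1) * of_real s)) has_vector_derivative
        exp (\<i> * l * (zeta k - 1) * of_real s) * (\<i> * l * (zeta k - 1))) (at s within S)"
      by (rule field_vector_diff_chain_within[OF has_vector_derivative_of_real[OF DERIV_ident], simplified o_def id_def mult_1_left of_real_1])
  qed
  moreover have "(\<Sum>k\<le>2. zeta k ^ Suc j * (exp (\<i> * l * (zeta k - 1) * of_real s) * (\<i> * l * (zeta k - 1))))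
      = \<i> * l * (expsum l (Suc j) s - expsum l j s)"
    unfolding expsum_def by (simp add: sum_distrib_left algebra_simps flip: sum_subtractf)
  ultimately show ?thesis
    unfolding expsum_def[abs_def] by metis
qed

text \<open>The cube roots of unity sum to zero, and so do their squares. For \<open>j = 2\<close>
  the value is \<open>3\<close>, so the kernel then jumps at \<open>0\<close>; differentiation
  therefore stops after two steps.\<close>

lemma expsum_0:
  assumes "j < 2"
  shows "expsum l j 0 = 0"
  using assms zeta_sum zeta_1_power2 zeta_2_power2
  by (auto simp: expsum_eq less_2_cases_iff power2_eq_square add_ac)

text \<open>The derivative is bounded on the half-line, and the vanishing at \<open>0\<close> makes
  the extension by zero continuous.\<close>

lemma kern_lipschitz:
  assumes l: "l \<in> Omega0_minus" and j: "j < 2"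
  shows "norm (kern l j s - kern l j s') \<le> 6 * norm l * \<bar>s - s'\<bar>"
proof -
  have E: "norm (expsum l j s - expsum l j s') \<le> 6 * norm l * \<bar>s - s'\<bar>" if "s \<ge> 0" "s' \<ge> 0" for s s'
  proof -
    have "norm (expsum l j s - expsum l j s') \<le> 6 * norm l * norm (s - s')"
    proof (rule differentiable_bound[where S = "{0..}"])
      fix x :: real assume x: "x \<in> {0..}"
      show "(expsum l j has_derivative (\<lambda>h. h *\<^sub>R (\<i> * l * (expsum l (Suc j) x - expsum l j x)))) (at x within {0..})"
        using expsum_has_vector_derivative unfolding has_vector_derivative_def .
      \<comment> \<open>The Lipschitz constant is \<open>norm l\<close> times two bounds of
        \<open>3\<close>, one for each sum of exponentials.\<close>
      have "norm (expsum l (Suc j) x - expsum l j x) \<le> 3 + 3"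
        using x l by (intro norm_triangle_le_diff add_mono norm_expsum_le) auto
      then have "norm (\<i> * l * (expsum l (Suc j) x - expsum l j x)) \<le> 6 * norm l"
        using mult_left_mono[of "norm (expsum l (Suc j) x - expsum l j x)" 6 "norm l"] by (simp add: norm_mult mult.commute)
      then show "onorm (\<lambda>h. h *\<^sub>R (\<i> * l * (expsum l (Suc j) x - expsum l j x))) \<le> 6 * norm l"
        by (simp add: onorm_scaleR_left onorm_id)
    qed (use that in auto)
    then show ?thesis by simp
  qed
  \<comment> \<open>For points on opposite sides of \<open>0\<close>, the negative one can be
    replaced by the origin: the kernel is zero at both, and the distance only decreases.\<close>
  have up: "6 * norm l * \<bar>t\<bar> \<le> 6 * norm l * \<bar>t - t'\<bar>" if "t \<ge> 0" "t' < 0" for t t' :: real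
    using that by (intro mult_left_mono) auto
  show ?thesis
    using E[of s s'] E[of s 0] E[of 0 s'] up[of s s'] up[of s' s] expsum_0[OF j, of l]
    by (auto simp: kern_def abs_minus_commute not_less)
qed

lemma kern_has_vector_derivative:
  assumes "s \<noteq> 0"
  shows "(kern l j has_vector_derivative \<i> * l * (kern l (Suc j) s - kern l j s)) (at s)"
proof (cases "s < 0")
  case True
  have "((\<lambda>_. 0) has_vector_derivative (0::complex)) (at s)"
    by simp
  moreover have "\<forall>\<^sub>F t in nhds s. (\<lambda>_. 0) t = kern l j t"
    using eventually_nhds_in_open[of "{..<0}" s] True by (auto elim!: eventually_mono simp: kern_def)
  ultimately show ?thesis
    using True by (subst has_vector_derivative_cong_ev[where g = "\<lambda>_. 0"]) (auto simp: kern_def eventually_mono)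
next
  case False
  then have "\<forall>\<^sub>F t in nhds s. t \<in> UNIV \<longrightarrow> kern l j t = expsum l j t"
    using eventually_nhds_in_open[of "{0<..}" s] assms by (auto elim!: eventually_mono simp: kern_def)
  then show ?thesis
    using False expsum_has_vector_derivative
    by (subst has_vector_derivative_cong_ev[where g = "expsum l j"]) (auto simp: kern_def)
qed

text \<open>The outer exponential merges with those in \<open>s2\<close>, the square of
  \<open>\<i> * l\<close> gives the minus sign, and the extension of \<open>kern\<close> by zero
  takes over the role of the indicator. The integral then runs over the whole line with an integrand
  differentiable in \<open>x\<close> off the diagonal.\<close>

lemma phi0_integrand_eq:
  "indicator {..x} t *\<^sub>R phi0_integrand q l f x t
    = - (1 / (3 * l^2)) * (kern l 0 (x - t) * (of_real (q t) * f t))"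
proof (cases "t \<le> x")
  case True
  have "exp (\<i> * l * of_real (t - x)) * s2 (\<i> * l * of_real (x - t)) = expsum l 0 (x - t) / 3"
  proof -
    have "exp (\<i> * l * of_real (t - x)) * s2 (\<i> * l * of_real (x - t))
      = (1/3) * (\<Sum>k=0..2. exp (\<i> * l * of_real (t - x)) * (zeta k powi (-2) * exp (zeta k * (\<i> * l * of_real (x - t)))))"
      unfolding s2_def by (simp add: sum_distrib_left mult.left_commute)
    also have "(\<Sum>k=0..2. exp (\<i> * l * of_real (t - x)) * (zeta k powi (-2) * exp (zeta k * (\<i> * l * of_real (x - t)))))
      = (\<Sum>k\<le>2. zeta k ^ Suc 0 * exp (\<i> * l * (zeta k - 1) * of_real (x - t)))"
    proof (rule sum.cong)
      fix k :: nat assume "k \<in> {..2}"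
      then have "zeta k powi (-2) = zeta k" by (intro zeta_powi) simp
      moreover have "\<i> * l * (zeta k - 1) * of_real (x - t)
          = \<i> * l * of_real (t - x) + zeta k * (\<i> * l * of_real (x - t))"
        by (simp add: algebra_simps)
      ultimately show "exp (\<i> * l * of_real (t - x)) * (zeta k powi (-2) * exp (zeta k * (\<i> * l * of_real (x - t))))
          = zeta k ^ Suc 0 * exp (\<i> * l * (zeta k - 1) * of_real (x - t))"
        by (simp add: exp_add mult_ac)
    qed auto
    finally show ?thesis by (simp add: expsum_def)
  qed
  note eq = this
  have "phi0_integrand q l f x t = exp (\<i> * l * of_real (t - x)) * s2 (\<i> * l * of_real (x - t)) / (\<i> * l)^2 * (of_real (q t) * f t)"
    by (simp add: phi0_integrand_def)
  also have "\<dots> = - (1 / (3 * l^2)) * (kern l 0 (x - t) * (of_real (q t) * f t))"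
    unfolding eq using True by (simp add: kern_def power_mult_distrib)
  finally show ?thesis using True by simp
qed (simp add: kern_def)

lemma phi0_map_eq:
  "phi0_map q l f x = 1 - \<i> / (3 * l^2) * (LINT t|lebesgue. kern l 0 (x - t) * (of_real (q t) * f t))"
  unfolding phi0_map_def set_lebesgue_integral_def phi0_integrand_eq by simp

section \<open>Volterra operators with these kernels\<close>

lemma integrable_kern_mult:
  assumes l: "l \<in> Omega0_minus" and g: "integrable lebesgue g"
  shows "integrable lebesgue (\<lambda>t. kern l j (x - t) * g t)"
proof (rule Bochner_Integration.integrable_bound)
  show "integrable lebesgue (\<lambda>t. 3 * norm (g t))"
    using g by simp
  show "(\<lambda>t. kern l j (x - t) * g t) \<in> borel_measurable lebesgue"
    using g borel_measurable_kern by (intro borel_measurable_times) auto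
  show "AE t in lebesgue. norm (kern l j (x - t) * g t) \<le> norm (3 * norm (g t))"
    using norm_kern_le[OF l] by (intro AE_I2) (simp add: norm_mult mult_right_mono)
qed

lemma norm_integral_kern_mult_le:
  assumes l: "l \<in> Omega0_minus" and g: "g \<in> borel_measurable lebesgue"
    and h: "integrable lebesgue (\<lambda>t. indicator {..x} t * h t)"
    and gh: "\<And>t. t \<le> x \<Longrightarrow> norm (g t) \<le> h t"
  shows "norm (LINT t|lebesgue. kern l j (x - t) * g t) \<le> 3 * (LINT t|lebesgue. indicator {..x} t * h t)"
proof -
  have "norm (LINT t|lebesgue. kern l j (x - t) * g t) \<le> (LINT t|lebesgue. 3 * (indicator {..x} t * h t))"
  proof (rule Bochner_Integration.integral_norm_bound_integral)
    show b: "norm (kern l j (x - t) * g t) \<le> 3 * (indicator {..x} t * h t)" for t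
    proof (cases "t \<le> x")
      case True
      then show ?thesis
        using mult_mono[OF norm_kern_le[OF l] gh[OF True]] by (simp add: norm_mult)
    qed (simp add: kern_def)
    show i: "integrable lebesgue (\<lambda>t. 3 * (indicator {..x} t * h t))"
      using h by (rule integrable_mult_right)
    show "integrable lebesgue (\<lambda>t. kern l j (x - t) * g t)"
    proof (rule Bochner_Integration.integrable_bound[OF i])
      show "(\<lambda>t. kern l j (x - t) * g t) \<in> borel_measurable lebesgue"
        using g borel_measurable_kern by (intro borel_measurable_times) auto
      show "AE t in lebesgue. norm (kern l j (x - t) * g t) \<le> norm (3 * (indicator {..x} t * h t))"
        using b by (intro AE_I2) (rule order_trans, assumption, simp)
    qed
  qed
  then show ?thesis by simp
qed

section \<open>Differentiation of convolutions with the kernel\<close>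

lemma has_vector_derivative_iff_quotient:
  "(f has_vector_derivative d) (at x) \<longleftrightarrow> ((\<lambda>y. (f y - f x) /\<^sub>R (y - x)) \<longlongrightarrow> d) (at x)"
proof -
  have "norm ((f y - f x) - (y - x) *\<^sub>R d) / norm (y - x) = norm ((f y - f x) /\<^sub>R (y - x) - d)"
    if "y \<noteq> x" for y
  proof -
    have "(f y - f x) /\<^sub>R (y - x) - d = ((f y - f x) - (y - x) *\<^sub>R d) /\<^sub>R (y - x)"
      using that by (simp add: scaleR_diff_right)
    then show ?thesis by (simp add: divide_inverse)
  qed
  then have "\<forall>\<^sub>F y in at x. norm ((f y - f x) - (y - x) *\<^sub>R d) / norm (y - x) = norm ((f y - f x) /\<^sub>R (y - x) - d)"
    by (auto simp: eventually_at_filter)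
  note eq = tendsto_cong[OF this]
  show ?thesis
    unfolding has_vector_derivative_def has_derivative_iff_norm eq
    by (subst (2) Lim_null) (simp add: bounded_linear_scaleR_left tendsto_norm_zero_iff)
qed

text \<open>The Lipschitz bound dominates the difference quotients by
  \<open>6 * norm l * norm (g t)\<close>, so integrability of \<open>g\<close> suffices. The
  continuity of the kernel at \<open>0\<close> is the reason why no boundary term \<open>g x\<close>
  appears.\<close>

lemma kern_convolution_has_vector_derivative:
  assumes l: "l \<in> Omega0_minus" and j: "j < 2" and g: "integrable lebesgue g"
  shows "((\<lambda>x. LINT t|lebesgue. kern l j (x - t) * g t) has_vector_derivative
    \<i> * l * ((LINT t|lebesgue. kern l (Suc j) (x - t) * g t) - (LINT t|lebesgue. kern l j (x - t) * g t))) (at x)"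
proof -
  have gm: "g \<in> borel_measurable lebesgue" using g by auto
  note km = borel_measurable_times[OF borel_measurable_kern gm]
  let ?Q = "\<lambda>y t. (kern l j (y - t) * g t - kern l j (x - t) * g t) /\<^sub>R (y - x)"
  let ?D = "\<lambda>t. \<i> * l * (kern l (Suc j) (x - t) * g t - kern l j (x - t) * g t)"
  have "((\<lambda>y. LINT t|lebesgue. ?Q y t) \<longlongrightarrow> (LINT t|lebesgue. ?D t)) (at x)"
  proof (rule integral_dominated_convergence_at[where S = UNIV and h = "\<lambda>t. 6 * norm l * norm (g t)"])
    show "?D \<in> borel_measurable lebesgue" "?Q y \<in> borel_measurable lebesgue" for y
      by (intro borel_measurable_times borel_measurable_diff borel_measurable_scaleR borel_measurable_const
          borel_measurable_kern gm)+
    show "integrable lebesgue (\<lambda>t. 6 * norm l * norm (g t))"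
      using g by simp
    show "AE t in lebesgue. ((\<lambda>y. ?Q y t) \<longlongrightarrow> ?D t) (at x)"
    proof -
      \<comment> \<open>The kernel may have a kink at \<open>0\<close>, which affects only the null
        set \<open>t = x\<close>.\<close>
      have "((\<lambda>y. ?Q y t) \<longlongrightarrow> ?D t) (at x)" if "t \<noteq> x" for t
      proof -
        have dy: "((\<lambda>y. y - t) has_vector_derivative 1) (at x)"
          by (auto simp: has_vector_derivative_def intro!: derivative_eq_intros)
        have "((\<lambda>y. kern l j (y - t)) has_vector_derivative \<i> * l * (kern l (Suc j) (x - t) - kern l j (x - t))) (at x)"
          using vector_diff_chain_at[OF dy, of "kern l j"] kern_has_vector_derivative[of "x - t" l j] that
          by (simp add: o_def)
        then have "((\<lambda>y. kern l j (y - t) * g t) has_vector_derivative ?D t) (at x)"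
          by (rule has_vector_derivative_eq_rhs[OF has_vector_derivative_mult_left]) (simp add: algebra_simps)
        then show ?thesis
          unfolding has_vector_derivative_iff_quotient .
      qed
      then show ?thesis
        using AE_lborel_singleton[of x] by (auto intro: AE_completion elim!: eventually_mono)
    qed
    show "norm (?Q y t) \<le> 6 * norm l * norm (g t)" if "y \<noteq> x" for y t
    proof -
      have "norm (kern l j (y - t) * g t - kern l j (x - t) * g t) \<le> 6 * norm l * \<bar>y - x\<bar> * norm (g t)"
        using mult_right_mono[OF kern_lipschitz[OF l j, of "y - t" "x - t"] norm_ge_zero[of "g t"]]
        by (simp flip: norm_mult left_diff_distrib)
      then have "norm (kern l j (y - t) * g t - kern l j (x - t) * g t) / \<bar>y - x\<bar> \<le> 6 * norm l * norm (g t)"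
        using that by (subst pos_divide_le_eq) (simp_all add: mult_ac)
      then show ?thesis
        by (simp only: norm_scaleR abs_inverse divide_inverse mult.commute)
    qed
  qed auto
  moreover have "(LINT t|lebesgue. ?Q y t) =
      ((LINT t|lebesgue. kern l j (y - t) * g t) - (LINT t|lebesgue. kern l j (x - t) * g t)) /\<^sub>R (y - x)" for y
    using integrable_kern_mult[OF l g] by simp
  moreover have "(LINT t|lebesgue. ?D t) =
     \<i> * l * ((LINT t|lebesgue. kern l (Suc j) (x - t) * g t) - (LINT t|lebesgue. kern l j (x - t) * g t))"
    using integrable_kern_mult[OF l g] by simp
  ultimately show ?thesis
    unfolding has_vector_derivative_iff_quotient by (simp only:)
qed

section \<open>The weight for the Volterra operator and the integrability of the potential\<close>

text \<open>The weight is \<open>1\<close> far to the left, where \<open>q\<close> has little mass,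
  and grows exponentially afterwards. On the growing part the quotient \<open>w t / w x\<close> is
  \<open>exp (M * (t - x))\<close>, so by Cauchy-Schwarz its integral against
  \<open>\<bar>q t\<bar>\<close> is small for large \<open>M\<close>.\<close>

lemma ex_Volterra_weight:
  fixes q :: "real \<Rightarrow> real"
  assumes q1: "integrable lebesgue q" and q2: "integrable lebesgue (\<lambda>x. (q x)\<^sup>2)" and e: "e > 0"
  shows "\<exists>w :: real \<Rightarrow> real. (\<forall>x. 1 \<le> w x) \<and>
    (\<forall>x. integrable lebesgue (\<lambda>t. indicator {..x} t * (\<bar>q t\<bar> * w t))) \<and>
    (\<forall>x. (LINT t|lebesgue. indicator {..x} t * (\<bar>q t\<bar> * w t)) \<le> e * w x)"
proof -
  have qm [measurable]: "q \<in> borel_measurable lebesgue" using q1 by auto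
  have "(\<lambda>n. LINT t|lebesgue. indicator {..- real n} t * \<bar>q t\<bar>) \<longlonglongrightarrow> (LINT t::real|lebesgue. (0::real))"
  proof (rule integral_dominated_convergence[where w = "\<lambda>t. \<bar>q t\<bar>"])
    show "AE t in lebesgue. (\<lambda>n. indicator {..- real n} t * \<bar>q t\<bar>) \<longlonglongrightarrow> 0"
    proof (intro AE_I2 tendsto_eventually)
      fix t
      obtain N :: nat where "- t < real N" using reals_Archimedean2 by blast
      then show "\<forall>\<^sub>F n in sequentially. indicator {..- real n} t * \<bar>q t\<bar> = 0"
        by (intro eventually_mono[OF eventually_ge_at_top[of N]]) (auto simp: indicator_def)
    qed
    show "(\<lambda>t. indicator {..- real n} t * \<bar>q t\<bar>) \<in> borel_measurable lebesgue" for n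
      by (intro borel_measurable_times borel_measurable_indicator) auto
  qed (use q1 in \<open>auto simp: indicator_def\<close>)
  then have "\<forall>\<^sub>F n in sequentially. (LINT t|lebesgue. indicator {..- real n} t * \<bar>q t\<bar>) < e / 2"
    using e by (intro order_tendstoD) auto
  then obtain N where N: "(LINT t|lebesgue. indicator {..- real N} t * \<bar>q t\<bar>) < e / 2"
    by (auto simp: eventually_sequentially)
  define B where "B = (LINT t|lebesgue. (q t)\<^sup>2)"
  have B: "B \<ge> 0" by (simp add: B_def)
  \<comment> \<open>The choice makes \<open>B / (2 * M)\<close> at most the square of
    \<open>e / 2\<close>; the summand \<open>1\<close> keeps \<open>M\<close> positive when
    \<open>B = 0\<close>.\<close>
  define M where "M = 2 * B / e\<^sup>2 + 1"
  have M: "M > 0" "2 * B / e\<^sup>2 \<le> M" using B by (auto simp: M_def add_nonneg_pos)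
  define w where "w t = exp (M * max 0 (t + real N))" for t
  have w1: "1 \<le> w t" for t using M by (simp add: w_def)
  have [measurable]: "w \<in> borel_measurable lebesgue"
  proof -
    have "w \<in> borel_measurable borel" unfolding w_def by measurable
    then show ?thesis by (simp add: measurable_completion)
  qed
  have iN: "integrable lebesgue (\<lambda>t. indicator {..- real N} t * \<bar>q t\<bar>)"
    using integrable_mult_indicator[of "{..- real N}" lebesgue "\<lambda>t. \<bar>q t\<bar>"] q1 by simp
  have sq: "(indicator {..x} t * exp (M * (t - x)))\<^sup>2 = indicator {..x} t * exp ((2 * M) * (t - x))" for x t
    by (simp add: indicator_def power2_eq_square algebra_simps flip: exp_add)
  have em: "(\<lambda>t. indicator {..x} t * exp (M * (t - x))) \<in> borel_measurable lebesgue" for x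
    using exp_integral_atMost(1)[OF M(1)] by (rule borel_measurable_integrable)
  have M2: "2 * M > 0" using M by simp
  note CS = integral_abs_mult_Cauchy_Schwarz[OF qm em q2, unfolded sq, OF exp_integral_atMost(1)[OF M2], unfolded exp_integral_atMost(2)[OF M2]]
  \<comment> \<open>The first summand covers \<open>t \<le> - real N\<close>, where
    \<open>w t = 1\<close>; the second covers the remaining \<open>t \<le> x\<close>. Each will
    contribute at most \<open>e / 2 * w x\<close>.\<close>
  let ?h = "\<lambda>x t. indicator {..- real N} t * \<bar>q t\<bar> + w x * \<bar>q t * (indicator {..x} t * exp (M * (t - x)))\<bar>"
  have ih: "integrable lebesgue (?h x)" for x
    using iN CS(1) by (intro Bochner_Integration.integrable_add integrable_mult_right)
  have le: "indicator {..x} t * (\<bar>q t\<bar> * w t) \<le> ?h x t" for x t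
  proof (cases "t \<le> x \<and> - real N < t")
    case True
    then have "w t = exp (M * (t - x)) * w x"
      by (simp add: w_def algebra_simps flip: exp_add)
    then show ?thesis
      using True by (simp add: abs_mult indicator_def mult_ac)
  next
    case False
    then show ?thesis
      using w1[of x] by (auto simp: indicator_def w_def not_less)
  qed
  have int: "integrable lebesgue (\<lambda>t. indicator {..x} t * (\<bar>q t\<bar> * w t))" for x
  proof (rule Bochner_Integration.integrable_bound[OF ih[of x]])
    show "AE t in lebesgue. norm (indicator {..x} t * (\<bar>q t\<bar> * w t)) \<le> norm (?h x t)"
    proof (rule AE_I2)
      fix t
      have "norm (indicator {..x} t * (\<bar>q t\<bar> * w t)) = indicator {..x} t * (\<bar>q t\<bar> * w t)"
        using w1[of t] by (simp add: abs_mult)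
      also have "\<dots> \<le> norm (?h x t)" using le[of x t] by simp
      finally show "norm (indicator {..x} t * (\<bar>q t\<bar> * w t)) \<le> norm (?h x t)" .
    qed
  qed (intro borel_measurable_times borel_measurable_indicator, auto)
  have "(LINT t|lebesgue. indicator {..x} t * (\<bar>q t\<bar> * w t)) \<le> e * w x" for x
  proof -
    have "(LINT t|lebesgue. indicator {..x} t * (\<bar>q t\<bar> * w t)) \<le> (LINT t|lebesgue. ?h x t)"
      using int ih le by (rule integral_mono)
    also have "\<dots> = (LINT t|lebesgue. indicator {..- real N} t * \<bar>q t\<bar>)
        + w x * (LINT t|lebesgue. \<bar>q t * (indicator {..x} t * exp (M * (t - x)))\<bar>)"
      using iN CS(1)[of x] by (subst Bochner_Integration.integral_add) auto
    also have "\<dots> \<le> e / 2 * w x + w x * (e / 2)"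
    proof (intro add_mono mult_left_mono)
      show "(LINT t|lebesgue. indicator {..- real N} t * \<bar>q t\<bar>) \<le> e / 2 * w x"
        using N mult_left_mono[OF w1[of x], of "e / 2"] e by linarith
      have "sqrt B * sqrt (1 / (2 * M)) = sqrt (B / (2 * M))"
        by (simp flip: real_sqrt_mult)
      also have "\<dots> \<le> sqrt ((e / 2)\<^sup>2)"
        using M e by (intro real_sqrt_le_mono) (simp add: field_simps)
      also have "\<dots> = e / 2" using e by simp
      finally show "(LINT t|lebesgue. \<bar>q t * (indicator {..x} t * exp (M * (t - x)))\<bar>) \<le> e / 2"
        using CS(2)[of x] by (simp add: B_def)
      show "0 \<le> w x" using w1[of x] by simp
    qed
    finally show ?thesis by (simp add: algebra_simps)
  qed
  with w1 int show ?thesis by (intro exI[of _ w]) simp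
qed

text \<open>Integrability of \<open>q\<close> follows by Cauchy-Schwarz after writing
  \<open>q x\<close> as the product of \<open>q x * exp (a * \<bar>x\<bar>)\<close> and
  \<open>exp (- a * \<bar>x\<bar>)\<close>, both square integrable.\<close>

lemma integrable_of_exp_weighted_square:
  fixes q :: "real \<Rightarrow> real"
  assumes a: "a > 0" and q [measurable]: "q \<in> borel_measurable lebesgue"
    and i: "integrable lebesgue (\<lambda>x. \<bar>q x\<bar>^2 * exp (2 * a * \<bar>x\<bar>))"
  shows "integrable lebesgue q" "integrable lebesgue (\<lambda>x. (q x)\<^sup>2)"
proof -
  have em: "(\<lambda>x. exp (c * \<bar>x\<bar>)) \<in> borel_measurable lebesgue" for c :: real
  proof -
    have "(\<lambda>x. exp (c * \<bar>x\<bar>)) \<in> borel_measurable borel" by measurable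
    then show ?thesis by (simp add: measurable_completion)
  qed
  show "integrable lebesgue (\<lambda>x. (q x)\<^sup>2)"
  proof (rule Bochner_Integration.integrable_bound[OF i])
    have "(q x)\<^sup>2 * 1 \<le> (q x)\<^sup>2 * exp (2 * a * \<bar>x\<bar>)" for x
      using a by (intro mult_left_mono) auto
    then show "AE x in lebesgue. norm ((q x)\<^sup>2) \<le> norm (\<bar>q x\<bar>\<^sup>2 * exp (2 * a * \<bar>x\<bar>))"
      by (intro AE_I2) (simp add: abs_mult)
  qed measurable
  have a2: "2 * a > 0" using a by simp
  let ?l = "\<lambda>t. indicator {..0} t * exp (2 * a * (t - 0)) :: real"
  \<comment> \<open>A decaying exponential on the left half-line plus its reflection majorizes
    \<open>exp (- 2 * a * \<bar>x\<bar>)\<close>; counting the origin twice does no harm.\<close>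
  have e: "integrable lebesgue (\<lambda>t. ?l t + ?l (0 + (-1) * t))"
    using exp_integral_atMost(1)[OF a2, of 0] lebesgue_integrable_real_affine_iff[of "-1" ?l 0]
    by (intro Bochner_Integration.integrable_add) auto
  have "integrable lebesgue (\<lambda>x. exp (2 * - a * \<bar>x\<bar>))"
    by (rule Bochner_Integration.integrable_bound[OF e em]) (auto simp: indicator_def)
  moreover have "(exp (- a * \<bar>x\<bar>))\<^sup>2 = exp (2 * - a * \<bar>x\<bar>)" "(q x * exp (a * \<bar>x\<bar>))\<^sup>2 = \<bar>q x\<bar>^2 * exp (2 * a * \<bar>x\<bar>)" for x
    by (simp_all add: power_mult_distrib exp_double[symmetric] mult.assoc)
  ultimately have "integrable lebesgue (\<lambda>x. \<bar>(q x * exp (a * \<bar>x\<bar>)) * exp (- a * \<bar>x\<bar>)\<bar>)"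
    using i em[of a] em[of "- a"] by (intro integral_abs_mult_Cauchy_Schwarz(1)) auto
  moreover have "(q x * exp (a * \<bar>x\<bar>)) * exp (- a * \<bar>x\<bar>) = q x" for x
    by (simp add: mult.assoc flip: exp_add)
  ultimately have "integrable lebesgue (\<lambda>x. \<bar>q x\<bar>)"
    by (simp only:)
  then show "integrable lebesgue q"
    using q by (rule integrable_abs_cancel)
qed

section \<open>Successive approximations\<close>

lemma phi0_approx_0 [simp]: "phi0_approx q l 0 x = 1"
  by (simp add: phi0_approx_def)

lemma phi0_approx_Suc:
  "phi0_approx q l (Suc n) x =
    1 - \<i> / (3 * l^2) * (LINT t|lebesgue. kern l 0 (x - t) * (of_real (q t) * phi0_approx q l n t))"
  by (simp add: phi0_approx_def phi0_map_eq)

lemma integrable_of_real_mult_bounded: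
  fixes q :: "real \<Rightarrow> real" and f :: "real \<Rightarrow> complex"
  assumes q: "integrable lebesgue q" and f: "f \<in> borel_measurable lebesgue" and B: "\<And>t. norm (f t) \<le> B"
  shows "integrable lebesgue (\<lambda>t. of_real (q t) * f t)"
proof (rule Bochner_Integration.integrable_bound)
  show "integrable lebesgue (\<lambda>t. B * \<bar>q t\<bar>)"
    using q by (intro integrable_mult_right integrable_abs)
  show "(\<lambda>t. of_real (q t) * f t) \<in> borel_measurable lebesgue"
    using q f by (intro borel_measurable_times borel_measurable_of_real) auto
  have "norm (of_real (q t) * f t) \<le> norm (B * \<bar>q t\<bar>)" for t
    using mult_right_mono[OF B[of t], of "\<bar>q t\<bar>"] order_trans[OF norm_ge_zero B[of t]]
    by (simp add: norm_mult abs_mult mult.commute)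
  then show "AE t in lebesgue. norm (of_real (q t) * f t) \<le> norm (B * \<bar>q t\<bar>)"
    by (intro AE_I2)
qed

text \<open>The kernel bound \<open>3\<close> cancels the \<open>3\<close> of the prefactor. This is
  why \<open>rr\<close> occurs later with constant one.\<close>

lemma norm_volterra_term_le:
  fixes q :: "real \<Rightarrow> real" and f :: "real \<Rightarrow> complex"
  assumes l: "l \<in> Omega0_minus" and q: "q \<in> borel_measurable lebesgue" and f: "f \<in> borel_measurable lebesgue"
    and i: "integrable lebesgue (\<lambda>t. indicator {..x} t * (\<bar>q t\<bar> * b t))"
    and b: "\<And>t. t \<le> x \<Longrightarrow> norm (f t) \<le> b t"
  shows "norm (\<i> / (3 * l^2) * (LINT t|lebesgue. kern l j (x - t) * (of_real (q t) * f t)))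
    \<le> (LINT t|lebesgue. indicator {..x} t * (\<bar>q t\<bar> * b t)) / (norm l)^2"
proof -
  have "norm (LINT t|lebesgue. kern l j (x - t) * (of_real (q t) * f t))
      \<le> 3 * (LINT t|lebesgue. indicator {..x} t * (\<bar>q t\<bar> * b t))"
  proof (rule norm_integral_kern_mult_le[OF l _ i])
    show "(\<lambda>t. of_real (q t) * f t) \<in> borel_measurable lebesgue"
      using q f by (intro borel_measurable_times borel_measurable_of_real) auto
    show "norm (of_real (q t) * f t) \<le> \<bar>q t\<bar> * b t" if "t \<le> x" for t
      using b[OF that] by (simp add: norm_mult mult_left_mono)
  qed
  then have "norm (\<i> / (3 * l^2)) * norm (LINT t|lebesgue. kern l j (x - t) * (of_real (q t) * f t))
      \<le> 1 / (3 * (norm l)^2) * (3 * (LINT t|lebesgue. indicator {..x} t * (\<bar>q t\<bar> * b t)))"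
    by (intro mult_mono) (auto simp: norm_divide norm_mult norm_power)
  also have "\<dots> = (LINT t|lebesgue. indicator {..x} t * (\<bar>q t\<bar> * b t)) / (norm l)^2"
    by simp
  finally show ?thesis
    unfolding norm_mult .
qed

lemma norm_volterra_term_le_const:
  fixes q :: "real \<Rightarrow> real" and f :: "real \<Rightarrow> complex"
  assumes l: "l \<in> Omega0_minus" and q: "integrable lebesgue q" and f: "f \<in> borel_measurable lebesgue"
    and B: "\<And>t. norm (f t) \<le> B"
  shows "norm (\<i> / (3 * l^2) * (LINT t|lebesgue. kern l j (x - t) * (of_real (q t) * f t)))
    \<le> (LINT t|lebesgue. \<bar>q t\<bar>) / (norm l)^2 * B"
proof -
  have B0: "0 \<le> B" using order_trans[OF norm_ge_zero B] .
  have qB: "integrable lebesgue (\<lambda>t. \<bar>q t\<bar> * B)" using q by (intro integrable_mult_left integrable_abs)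
  have i: "integrable lebesgue (\<lambda>t. indicator {..x} t * (\<bar>q t\<bar> * B))"
    using integrable_mult_indicator[of "{..x}" lebesgue "\<lambda>t. \<bar>q t\<bar> * B"] qB by simp
  have "(LINT t|lebesgue. indicator {..x} t * (\<bar>q t\<bar> * B)) \<le> (LINT t|lebesgue. \<bar>q t\<bar> * B)"
    by (rule integral_mono[OF i qB]) (use B0 in \<open>auto simp: indicator_def\<close>)
  then have "(LINT t|lebesgue. indicator {..x} t * (\<bar>q t\<bar> * B)) / (norm l)^2 \<le> (LINT t|lebesgue. \<bar>q t\<bar>) / (norm l)^2 * B"
    using divide_right_mono by fastforce
  with norm_volterra_term_le[OF l _ f i B] q show ?thesis
    by (meson borel_measurable_integrable order_trans)
qed

lemma borel_measurable_kern_convolution: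
  assumes "l \<in> Omega0_minus" "integrable lebesgue g"
  shows "(\<lambda>x. LINT t|lebesgue. kern l 0 (x - t) * g t) \<in> borel_measurable lebesgue"
proof -
  have "continuous_on UNIV (\<lambda>x. LINT t|lebesgue. kern l 0 (x - t) * g t)"
    using kern_convolution_has_vector_derivative[OF assms(1) _ assms(2), of 0]
    by (auto intro!: continuous_at_imp_continuous_on has_vector_derivative_continuous)
  then show ?thesis
    by (intro measurable_completion) (simp add: borel_measurable_continuous_onI)
qed

text \<open>The bound grows with \<open>n\<close> and serves only to make the next integral exist;
  in the induction, \<open>1 + r * (1 + r) ^ n\<close> is at most
  \<open>(1 + r) ^ Suc n\<close>.\<close>

lemma phi0_approx_bounded_measurable:
  assumes l: "l \<in> Omega0_minus" and q: "integrable lebesgue q"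
  shows "phi0_approx q l n \<in> borel_measurable lebesgue \<and>
    (\<forall>x. norm (phi0_approx q l n x) \<le> (1 + (LINT t|lebesgue. \<bar>q t\<bar>) / (norm l)^2) ^ n)"
proof (induction n)
  case 0
  then show ?case by (simp add: phi0_approx_def)
next
  case (Suc n)
  define r where "r = (LINT t|lebesgue. \<bar>q t\<bar>) / (norm l)^2"
  have r: "r \<ge> 0" by (simp add: r_def)
  have f: "phi0_approx q l n \<in> borel_measurable lebesgue" and B: "norm (phi0_approx q l n x) \<le> (1 + r) ^ n" for x
    using Suc by (auto simp: r_def)
  have "norm (phi0_approx q l (Suc n) x) \<le> (1 + r) ^ Suc n" for x
  proof -
    have "norm (phi0_approx q l (Suc n) x) \<le> 1 + r * (1 + r) ^ n"
      unfolding phi0_approx_Suc r_def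
      by (rule order_trans[OF norm_triangle_ineq4])
        (use norm_volterra_term_le_const[OF l q f B] in \<open>simp add: r_def\<close>)
    also have "\<dots> \<le> (1 + r) ^ n + r * (1 + r) ^ n"
      using r by (intro add_mono one_le_power) auto
    finally show ?thesis by (simp add: algebra_simps)
  qed
  moreover have "phi0_approx q l (Suc n) \<in> borel_measurable lebesgue"
    unfolding phi0_approx_Suc[abs_def]
    using borel_measurable_kern_convolution[OF l integrable_of_real_mult_bounded[OF q f B]]
    by (intro borel_measurable_diff borel_measurable_times borel_measurable_const)
  ultimately show ?case by (simp add: r_def)
qed

lemmas phi0_approx_measurable = phi0_approx_bounded_measurable[THEN conjunct1]
lemmas norm_phi0_approx_le = phi0_approx_bounded_measurable[THEN conjunct2, rule_format]

lemma integrable_phi0_approx: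
  assumes l: "l \<in> Omega0_minus" and q: "integrable lebesgue q"
  shows "integrable lebesgue (\<lambda>t. of_real (q t) * phi0_approx q l n t)"
  by (rule integrable_of_real_mult_bounded[OF q phi0_approx_measurable[OF l q] norm_phi0_approx_le[OF l q]])

text \<open>The weight makes the Volterra operator a contraction, although its norm need not be small.\<close>
locale Volterra_weight =
  fixes q :: "real \<Rightarrow> real" and rho :: real and w :: "real \<Rightarrow> real"
  assumes q: "integrable lebesgue q"
    and rho: "rho > 0"
    and weight_ge_1: "1 \<le> w x"
    and weight_integrable: "integrable lebesgue (\<lambda>t. indicator {..x} t * (\<bar>q t\<bar> * w t))"
    and weight_integral: "(LINT t|lebesgue. indicator {..x} t * (\<bar>q t\<bar> * w t)) \<le> rho\<^sup>2 / 2 * w x"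
begin

text \<open>The weight inequality contributes \<open>rho^2 / 2\<close>, and the division by
  \<open>(norm l)^2 \<ge> rho^2\<close> leaves the factor \<open>1/2\<close>.\<close>

lemma contraction:
  assumes l: "l \<in> Omega0_minus" "norm l \<ge> rho" and f: "f \<in> borel_measurable lebesgue"
    and b: "\<And>t. norm (f t) \<le> c * w t"
  shows "norm (\<i> / (3 * l^2) * (LINT t|lebesgue. kern l 0 (x - t) * (of_real (q t) * f t))) \<le> c / 2 * w x"
proof -
  have c: "c \<ge> 0"
    using order_trans[OF norm_ge_zero b[of 0]] weight_ge_1[of 0] by (simp add: zero_le_mult_iff)
  have i: "integrable lebesgue (\<lambda>t. indicator {..x} t * (\<bar>q t\<bar> * (c * w t)))"
    using integrable_mult_right[OF weight_integrable, of c x] by (simp add: mult_ac)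
  have "norm (\<i> / (3 * l^2) * (LINT t|lebesgue. kern l 0 (x - t) * (of_real (q t) * f t)))
    \<le> (LINT t|lebesgue. indicator {..x} t * (\<bar>q t\<bar> * (c * w t))) / (norm l)^2"
    using norm_volterra_term_le[OF l(1) borel_measurable_integrable[OF q] f i b] .
  also have "(LINT t|lebesgue. indicator {..x} t * (\<bar>q t\<bar> * (c * w t)))
      = c * (LINT t|lebesgue. indicator {..x} t * (\<bar>q t\<bar> * w t))"
    by (subst integral_mult_right_zero[symmetric]) (simp add: mult_ac)
  also have "c * (LINT t|lebesgue. indicator {..x} t * (\<bar>q t\<bar> * w t)) / (norm l)^2 \<le> c * (rho\<^sup>2 / 2 * w x) / rho\<^sup>2"
    using c rho l(2) weight_integral[of x] weight_ge_1[of x]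
    by (intro frac_le mult_left_mono power_mono) auto
  also have "\<dots> = c / 2 * w x" using rho by simp
  finally show ?thesis .
qed

lemma phi0_approx_Suc_diff:
  assumes l: "l \<in> Omega0_minus" "norm l \<ge> rho"
  shows "norm (phi0_approx q l (Suc n) x - phi0_approx q l n x) \<le> (1/2) ^ Suc n * w x"
proof (induction n arbitrary: x)
  case 0
  show ?case
    using contraction[OF l, of "\<lambda>_. 1" 1 x] weight_ge_1 by (simp add: phi0_approx_Suc)
next
  case (Suc n)
  let ?f = "\<lambda>t. phi0_approx q l (Suc n) t - phi0_approx q l n t"
  have "phi0_approx q l (Suc (Suc n)) x - phi0_approx q l (Suc n) x
      = - (\<i> / (3 * l^2) * (LINT t|lebesgue. kern l 0 (x - t) * (of_real (q t) * ?f t)))"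
  proof -
    have "(LINT t|lebesgue. kern l 0 (x - t) * (of_real (q t) * ?f t)) =
      (LINT t|lebesgue. kern l 0 (x - t) * (of_real (q t) * phi0_approx q l (Suc n) t)) -
      (LINT t|lebesgue. kern l 0 (x - t) * (of_real (q t) * phi0_approx q l n t))"
      using integrable_kern_mult[OF l(1) integrable_phi0_approx[OF l(1) q]]
      by (subst Bochner_Integration.integral_diff[symmetric]) (auto simp: algebra_simps)
    then show ?thesis
      unfolding phi0_approx_Suc[of q l "Suc n"] phi0_approx_Suc[of q l n x]
      by (simp only: right_diff_distrib) simp
  qed
  then have "norm (phi0_approx q l (Suc (Suc n)) x - phi0_approx q l (Suc n) x)
      = norm (\<i> / (3 * l^2) * (LINT t|lebesgue. kern l 0 (x - t) * (of_real (q t) * ?f t)))"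
    by (simp only: norm_minus_cancel)
  also have "\<dots> \<le> (1/2) ^ Suc n / 2 * w x"
    using phi0_approx_measurable[OF l(1) q] by (intro contraction l Suc borel_measurable_diff)
  finally show ?case by simp
qed

lemma phi0_approx_diff:
  assumes l: "l \<in> Omega0_minus" "norm l \<ge> rho"
  shows "norm (phi0_approx q l (n + k) x - phi0_approx q l n x) \<le> (1/2) ^ n * w x"
proof -
  \<comment> \<open>This is the partial geometric sum in closed form, which unlike the final bound
    is strong enough for the induction on \<open>k\<close>.\<close>
  have "norm (phi0_approx q l (n + k) x - phi0_approx q l n x) \<le> ((1/2) ^ n - (1/2) ^ (n + k)) * w x"
  proof (induction k)
    case (Suc k)
    have "norm (phi0_approx q l (n + Suc k) x - phi0_approx q l n x)
        \<le> norm (phi0_approx q l (Suc (n + k)) x - phi0_approx q l (n + k) x)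
          + norm (phi0_approx q l (n + k) x - phi0_approx q l n x)"
      by (rule order_trans[OF _ norm_triangle_ineq]) simp
    also have "\<dots> \<le> (1/2) ^ Suc (n + k) * w x + ((1/2) ^ n - (1/2) ^ (n + k)) * w x"
      using phi0_approx_Suc_diff[OF l] Suc by (intro add_mono)
    also have "\<dots> = ((1/2) ^ n - (1/2) ^ (n + Suc k)) * w x"
      by (simp add: algebra_simps)
    finally show ?case .
  qed simp
  also have "\<dots> \<le> (1/2) ^ n * w x"
    using weight_ge_1[of x] by (intro mult_right_mono) auto
  finally show ?thesis .
qed

text \<open>The \<open>lim\<close> in the definition of \<open>phi0\<close> is informative only for
  convergent sequences; the geometric estimate supplies the Cauchy property.\<close>

lemma phi0_approx_tendsto:
  assumes l: "l \<in> Omega0_minus" "norm l \<ge> rho"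
  shows "(\<lambda>n. phi0_approx q l n x) \<longlonglongrightarrow> phi0 q l x"
proof -
  have "Cauchy (\<lambda>n. phi0_approx q l n x)"
  proof (rule CauchyI)
    fix e :: real assume e: "e > 0"
    have "(\<lambda>n. (1/2) ^ n * w x) \<longlonglongrightarrow> 0 * w x"
      by (intro tendsto_intros LIMSEQ_power_zero) auto
    then have "\<forall>\<^sub>F n in sequentially. (1/2) ^ n * w x < e / 2"
      using e by (intro order_tendstoD) auto
    then obtain N where N: "(1/2) ^ N * w x < e / 2"
      by (auto simp: eventually_sequentially)
    have *: "norm (phi0_approx q l n x - phi0_approx q l N x) < e / 2" if "n \<ge> N" for n
      using phi0_approx_diff[OF l, of N "n - N" x] that N by simp
    show "\<exists>N. \<forall>m\<ge>N. \<forall>n\<ge>N. norm (phi0_approx q l m x - phi0_approx q l n x) < e"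
    proof (intro exI[of _ N] allI impI)
      fix m n assume "m \<ge> N" "n \<ge> N"
      then show "norm (phi0_approx q l m x - phi0_approx q l n x) < e"
        using *[of m] *[of n] norm_triangle_ineq4[of "phi0_approx q l m x - phi0_approx q l N x"
            "phi0_approx q l n x - phi0_approx q l N x"] by simp
    qed
  qed
  then have "convergent (\<lambda>n. phi0_approx q l n x)"
    by (rule Cauchy_convergent)
  then show ?thesis
    unfolding phi0_def by (simp add: convergent_LIMSEQ_iff)
qed

text \<open>Let the later index tend to infinity in the preceding estimate. The rate does not depend
  on \<open>l\<close>.\<close>

lemma phi0_minus_approx:
  assumes l: "l \<in> Omega0_minus" "norm l \<ge> rho"
  shows "norm (phi0 q l x - phi0_approx q l n x) \<le> (1/2) ^ n * w x"
proof (rule LIMSEQ_le_const2)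
  show "(\<lambda>k. norm (phi0_approx q l (k + n) x - phi0_approx q l n x)) \<longlonglongrightarrow> norm (phi0 q l x - phi0_approx q l n x)"
    using phi0_approx_tendsto[OF l, of x] by (intro tendsto_intros LIMSEQ_ignore_initial_segment)
  show "\<exists>N. \<forall>k\<ge>N. norm (phi0_approx q l (k + n) x - phi0_approx q l n x) \<le> (1/2) ^ n * w x"
    using phi0_approx_diff[OF l, of n _ x] by (simp add: add.commute)
qed

lemma phi0_measurable:
  assumes l: "l \<in> Omega0_minus" "norm l \<ge> rho"
  shows "phi0 q l \<in> borel_measurable lebesgue"
  by (rule borel_measurable_LIMSEQ_metric[OF phi0_approx_measurable[OF l(1) q]]) (rule phi0_approx_tendsto[OF l])

lemma norm_phi0_approx_le_weight:
  assumes l: "l \<in> Omega0_minus" "norm l \<ge> rho"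
  shows "norm (phi0_approx q l n x) \<le> 2 * w x"
  using phi0_approx_diff[OF l, of 0 n x] weight_ge_1[of x]
    norm_triangle_ineq[of "phi0_approx q l n x - 1" 1] by simp

lemma solves_phi0_equation_phi0:
  assumes l: "l \<in> Omega0_minus" "norm l \<ge> rho"
  shows "solves_phi0_equation q l (phi0 q l)"
  unfolding solves_phi0_equation_def
proof (intro allI conjI)
  fix x
  let ?s = "\<lambda>n t. kern l 0 (x - t) * (of_real (q t) * phi0_approx q l n t)"
  let ?f = "\<lambda>t. kern l 0 (x - t) * (of_real (q t) * phi0 q l t)"
  \<comment> \<open>The constant is the product of the kernel bound \<open>3\<close> and the bound
    \<open>2 * w t\<close> for all iterates; being independent of \<open>n\<close>, this majorant
    permits the passage to the limit in the recursion.\<close>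
  let ?w = "\<lambda>t. 6 * (indicator {..x} t * (\<bar>q t\<bar> * w t))"
  have qm: "q \<in> borel_measurable lebesgue" using q by auto
  have fm: "?f \<in> borel_measurable lebesgue"
    using phi0_measurable[OF l] qm by (intro borel_measurable_times borel_measurable_kern) auto
  have sm: "?s n \<in> borel_measurable lebesgue" for n
    using phi0_approx_measurable[OF l(1) q] qm
    by (intro borel_measurable_times borel_measurable_kern) auto
  have wi: "integrable lebesgue ?w"
    using weight_integrable by (rule integrable_mult_right)
  have lim: "(\<lambda>n. ?s n t) \<longlonglongrightarrow> ?f t" for t
    by (intro tendsto_intros phi0_approx_tendsto[OF l])
  have bd: "norm (?s n t) \<le> ?w t" for n t
  proof (cases "t \<le> x")
    case True
    have "norm (?s n t) \<le> 3 * (\<bar>q t\<bar> * (2 * w t))"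
      unfolding norm_mult norm_of_real
      by (intro mult_mono norm_kern_le l norm_phi0_approx_le_weight) auto
    then show ?thesis using True by simp
  qed (simp add: kern_def)
  have fi: "integrable lebesgue ?f"
    by (rule integrable_dominated_convergence[OF fm sm wi]) (auto intro: lim bd)
  have "(\<lambda>n. LINT t|lebesgue. ?s n t) \<longlonglongrightarrow> (LINT t|lebesgue. ?f t)"
    by (rule integral_dominated_convergence[OF fm sm wi]) (auto intro: lim bd)
  then have "(\<lambda>n. phi0_approx q l (Suc n) x) \<longlonglongrightarrow> phi0_map q l (phi0 q l) x"
    unfolding phi0_approx_Suc phi0_map_eq by (intro tendsto_intros)
  moreover have "(\<lambda>n. phi0_approx q l (Suc n) x) \<longlonglongrightarrow> phi0 q l x"
    using phi0_approx_tendsto[OF l] by (rule LIMSEQ_Suc)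
  ultimately show "phi0 q l x = phi0_map q l (phi0 q l) x"
    using LIMSEQ_unique by blast
  show "set_integrable lebesgue {..x} (phi0_integrand q l (phi0 q l) x)"
    unfolding set_integrable_def phi0_integrand_eq using fi by (rule integrable_mult_right)
qed

lemma phi0_approx_holomorphic:
  "(\<lambda>l. phi0_approx q l n x) holomorphic_on (Omega0_minus \<inter> {l. rho < norm l})"
proof (induction n arbitrary: x)
  case 0
  then show ?case by simp
next
  case (Suc n)
  let ?S = "Omega0_minus \<inter> {l. rho < norm l}"
  \<comment> \<open>Using \<open>rho\<close> in place of \<open>norm l\<close> makes the bound on
    the iterates uniform over the whole open set.\<close>
  define r where "r = (LINT t|lebesgue. \<bar>q t\<bar>) / rho\<^sup>2"
  have S: "open ?S"
    by (intro open_Int open_Omega0_minus open_Collect_less continuous_intros)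
  have K: "(\<lambda>l. kern l 0 s) holomorphic_on ?S" for s
    unfolding kern_def expsum_def by (cases "s < 0") (auto intro!: holomorphic_intros)
  have b: "norm (phi0_approx q l n t) \<le> (1 + r) ^ n" if "l \<in> ?S" for l t
  proof -
    have "(LINT t|lebesgue. \<bar>q t\<bar>) / (norm l)\<^sup>2 \<le> r"
      unfolding r_def using that rho
      by (intro divide_left_mono power_mono mult_pos_pos zero_less_power) auto
    then have "(1 + (LINT t|lebesgue. \<bar>q t\<bar>) / (norm l)\<^sup>2) ^ n \<le> (1 + r) ^ n"
      by (intro power_mono) (auto intro!: add_nonneg_nonneg)
    then show ?thesis
      using norm_phi0_approx_le[of l q n t] that q by auto
  qed
  have "(\<lambda>l. LINT t|lebesgue. kern l 0 (x - t) * (of_real (q t) * phi0_approx q l n t)) holomorphic_on ?S"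
  proof (rule holomorphic_on_integral[OF S])
    show "(\<lambda>l. kern l 0 (x - t) * (of_real (q t) * phi0_approx q l n t)) holomorphic_on ?S" for t
      by (intro holomorphic_intros K Suc)
    show "(\<lambda>t. kern l 0 (x - t) * (of_real (q t) * phi0_approx q l n t)) \<in> borel_measurable lebesgue"
      if "l \<in> ?S" for l
      using integrable_kern_mult[OF _ integrable_phi0_approx[OF _ q]] that
      by (intro borel_measurable_integrable) auto
    show "norm (kern l 0 (x - t) * (of_real (q t) * phi0_approx q l n t)) \<le> 3 * (\<bar>q t\<bar> * (1 + r) ^ n)"
      if "l \<in> ?S" for l t
      unfolding norm_mult norm_of_real using that by (intro mult_mono norm_kern_le b) auto
    show "integrable lebesgue (\<lambda>t. 3 * (\<bar>q t\<bar> * (1 + r) ^ n))"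
      using q by (intro integrable_mult_right integrable_mult_left integrable_abs)
  qed
  moreover have "(\<lambda>l. \<i> / (3 * l^2)) holomorphic_on ?S"
    using rho by (intro holomorphic_intros) auto
  ultimately show ?case
    unfolding phi0_approx_Suc by (intro holomorphic_on_diff holomorphic_on_mult holomorphic_on_const)
qed

text \<open>At fixed \<open>x\<close> the error \<open>(1/2) ^ n * w x\<close> is the same for all
  admissible \<open>l\<close>, so the iterates converge uniformly and Weierstrass' theorem
  applies.\<close>

lemma phi0_holomorphic:
  "(\<lambda>l. phi0 q l x) holomorphic_on (Omega0_minus \<inter> {l. rho < norm l})"
proof (rule holomorphic_uniform_sequence[OF _ phi0_approx_holomorphic])
  let ?S = "Omega0_minus \<inter> {l. rho < norm l}"
  show S: "open ?S"
    by (intro open_Int open_Omega0_minus open_Collect_less continuous_intros)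
  fix l assume "l \<in> ?S"
  then obtain d where d: "d > 0" "cball l d \<subseteq> ?S"
    using S open_contains_cball by blast
  have "uniform_limit (cball l d) (\<lambda>n l. phi0_approx q l n x) (\<lambda>l. phi0 q l x) sequentially"
  proof (rule uniform_limitI)
    fix e :: real assume e: "e > 0"
    have "(\<lambda>n. (1/2) ^ n * w x) \<longlonglongrightarrow> 0 * w x"
      by (intro tendsto_intros LIMSEQ_power_zero) auto
    then have "\<forall>\<^sub>F n in sequentially. (1/2) ^ n * w x < e"
      using e by (intro order_tendstoD) auto
    then show "\<forall>\<^sub>F n in sequentially. \<forall>l\<in>cball l d. dist (phi0_approx q l n x) (phi0 q l x) < e"
    proof eventually_elim
      case (elim n)
      show ?case
      proof
        fix m assume "m \<in> cball l d"
        then have "m \<in> Omega0_minus" "norm m \<ge> rho" using d by auto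
        from phi0_minus_approx[OF this, of x n] elim
        show "dist (phi0_approx q m n x) (phi0 q m x) < e"
          by (simp add: dist_norm norm_minus_commute)
      qed
    qed
  qed
  with d show "\<exists>d. 0 < d \<and> cball l d \<subseteq> ?S \<and>
      uniform_limit (cball l d) (\<lambda>n l. phi0_approx q l n x) (\<lambda>l. phi0 q l x) sequentially"
    by blast
qed

end

section \<open>Expansions for large parameters\<close>

lemma Lnorm_1: "Lnorm 1 q = (LINT x|lebesgue. \<bar>q x\<bar>)"
  by (simp add: Lnorm_def)

lemma Lnorm_2: "Lnorm 2 q = sqrt (LINT x|lebesgue. (q x)\<^sup>2)"
  by (simp add: Lnorm_def powr_half_sqrt)

lemma ex_Volterra_weight_locale:
  assumes "integrable lebesgue q" "integrable lebesgue (\<lambda>x. (q x)\<^sup>2)" "rho > 0"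
  shows "\<exists>w. Volterra_weight q rho w"
proof -
  have "rho\<^sup>2 / 2 > 0" using assms by simp
  from ex_Volterra_weight[OF assms(1,2) this] obtain w where w: "\<forall>x. 1 \<le> w x"
    "\<forall>x. integrable lebesgue (\<lambda>t. indicator {..x} t * (\<bar>q t\<bar> * w t))"
    "\<forall>x. (LINT t|lebesgue. indicator {..x} t * (\<bar>q t\<bar> * w t)) \<le> rho\<^sup>2 / 2 * w x"
    by (elim exE conjE) (rule that)
  have "Volterra_weight q rho w"
    by (rule Volterra_weight.intro[OF assms(1,3) w[rule_format]])
  then show ?thesis by (rule exI[where P = "Volterra_weight q rho"])
qed

text \<open>Subtracting the integral of \<open>q\<close> removes the exponential with
  \<open>k = 0\<close>. The other two decay at rate \<open>c\<close>, and Cauchy-Schwarz against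
  \<open>q\<close> gives the norm of that decay, \<open>sqrt (1 / (2 * c))\<close>.\<close>

lemma norm_kern_tail_integral_le:
  assumes l: "l \<in> Omega0_minus" and q: "integrable lebesgue q" and q2: "integrable lebesgue (\<lambda>x. (q x)\<^sup>2)"
  shows "norm ((LINT t|lebesgue. kern l j (x - t) * of_real (q t)) - of_real (LINT t:{..x}|lebesgue. q t))
    \<le> 2 * (Lnorm 2 q * delta_hat l)"
proof -
  define d where "d = - (Im l * sqrt 3) - \<bar>Re l\<bar>"
  have d: "d > 0" using l by (simp add: d_def Omega0_minus_def mult.commute)
  define c where "c = sqrt 3 / 2 * d"
  have c: "c > 0" using d by (simp add: c_def)
  have qm: "q \<in> borel_measurable lebesgue" using q by auto
  have em: "(\<lambda>t. indicator {..x} t * exp (c * (t - x))) \<in> borel_measurable lebesgue"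
    using exp_integral_atMost(1)[OF c] by (rule borel_measurable_integrable)
  have c2: "2 * c > 0" using c by simp
  have sq: "(indicator {..x} t * exp (c * (t - x)))\<^sup>2 = indicator {..x} t * exp ((2 * c) * (t - x))" for t
    by (simp add: indicator_def power2_eq_square algebra_simps flip: exp_add)
  note CS = integral_abs_mult_Cauchy_Schwarz[OF qm em q2, unfolded sq, OF exp_integral_atMost(1)[OF c2],
      unfolded exp_integral_atMost(2)[OF c2]]
  have qi: "integrable lebesgue (\<lambda>t. indicator {..x} t *\<^sub>R q t)"
    using q by (intro integrable_mult_indicator) auto
  note qi' = integrable_of_real[OF qi, where 'a = complex]
  have ki: "integrable lebesgue (\<lambda>t. kern l j (x - t) * of_real (q t))"
    using q by (intro integrable_kern_mult[OF l]) simp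
  have "(LINT t|lebesgue. kern l j (x - t) * of_real (q t)) - of_real (LINT t:{..x}|lebesgue. q t)
      = (LINT t|lebesgue. kern l j (x - t) * of_real (q t) - of_real (indicator {..x} t *\<^sub>R q t))"
    unfolding set_lebesgue_integral_def integral_complex_of_real[symmetric]
    by (rule Bochner_Integration.integral_diff[OF ki qi', symmetric])
  also have "norm \<dots> \<le> (LINT t|lebesgue. 2 * \<bar>q t * (indicator {..x} t * exp (c * (t - x)))\<bar>)"
  proof (rule Bochner_Integration.integral_norm_bound_integral)
    show "integrable lebesgue (\<lambda>t. kern l j (x - t) * of_real (q t) - of_real (indicator {..x} t *\<^sub>R q t))"
      using ki qi' by (rule Bochner_Integration.integrable_diff)
    show "integrable lebesgue (\<lambda>t. 2 * \<bar>q t * (indicator {..x} t * exp (c * (t - x)))\<bar>)"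
      using CS(1) by (rule integrable_mult_right)
    show "norm (kern l j (x - t) * of_real (q t) - of_real (indicator {..x} t *\<^sub>R q t))
        \<le> 2 * \<bar>q t * (indicator {..x} t * exp (c * (t - x)))\<bar>" for t
    proof (cases "t \<le> x")
      case True
      then have "kern l j (x - t) * of_real (q t) - of_real (indicator {..x} t *\<^sub>R q t)
          = (expsum l j (x - t) - 1) * of_real (q t)"
        by (simp add: kern_def algebra_simps)
      moreover have "norm (expsum l j (x - t) - 1) \<le> 2 * exp (c * (t - x))"
      proof -
        have "- c * (x - t) = c * (t - x)" by (simp add: algebra_simps)
        then show ?thesis
          using norm_expsum_minus_1[of "x - t" l j, folded d_def, folded c_def] True by simp
      qed
      ultimately show ?thesis
        using True mult_right_mono[of "norm (expsum l j (x - t) - 1)" "2 * exp (c * (t - x))" "\<bar>q t\<bar>"]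
        by (simp add: norm_mult abs_mult mult_ac)
    qed (simp add: kern_def)
  qed
  also have "\<dots> \<le> 2 * (Lnorm 2 q * sqrt (1 / (2 * c)))"
    using CS(2) by (simp add: Lnorm_2)
  also have "\<dots> \<le> 2 * (Lnorm 2 q * delta_hat l)"
  proof (intro mult_left_mono)
    \<comment> \<open>Here \<open>2 * c = d * sqrt 3\<close>; dropping the factor
      \<open>sqrt 3\<close> leaves exactly \<open>delta_hat l\<close>.\<close>
    have "d * 1 \<le> d * sqrt 3" using d by (intro mult_left_mono) auto
    then have "sqrt (1 / (2 * c)) \<le> sqrt (1 / d)"
      using d by (intro real_sqrt_le_mono divide_left_mono) (auto simp: c_def mult.commute)
    also have "\<dots> = delta_hat l"
      using d by (simp add: delta_hat_def d_def[symmetric] powr_minus powr_half_sqrt real_sqrt_divide inverse_eq_divide flip: minus_divide_left)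
    finally show "sqrt (1 / (2 * c)) \<le> delta_hat l" .
  qed (simp_all add: Lnorm_2)
  finally show ?thesis .
qed

lemma not_AE_zero_imp_integral_power2_pos:
  assumes i: "integrable M (\<lambda>x. (q x)\<^sup>2)" and n: "\<not> (AE t in M. q t = (0::real))"
  shows "0 < (LINT x|M. (q x)\<^sup>2)"
proof -
  have "(LINT x|M. (q x)\<^sup>2) \<noteq> 0"
    using n integral_nonneg_eq_0_iff_AE[OF i] by simp
  moreover have "0 \<le> (LINT x|M. (q x)\<^sup>2)" by simp
  ultimately show ?thesis by linarith
qed

lemma not_AE_zero_imp_integral_abs_pos:
  assumes i: "integrable M q" and n: "\<not> (AE t in M. q t = (0::real))"
  shows "0 < (LINT x|M. \<bar>q x\<bar>)"
proof -
  have "(LINT x|M. \<bar>q x\<bar>) \<noteq> 0"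
    using n integral_nonneg_eq_0_iff_AE[OF integrable_abs[OF i]] by simp
  moreover have "0 \<le> (LINT x|M. \<bar>q x\<bar>)" by simp
  ultimately show ?thesis by linarith
qed

text \<open>\<open>jost_amplitude q l j x\<close> is the \<open>j\<close>-th derivative of \<open>u0 q l\<close> at \<open>x\<close>, divided by
  \<open>exp (\<i> * l * x)\<close>.\<close>
definition jost_amplitude :: "(real \<Rightarrow> real) \<Rightarrow> complex \<Rightarrow> nat \<Rightarrow> real \<Rightarrow> complex" where
  "jost_amplitude q l j x = (\<i> * l) ^ j *
     (1 - \<i> / (3 * l^2) * (LINT t|lebesgue. kern l j (x - t) * (of_real (q t) * phi0 q l t)))"

definition C_hat :: "(real \<Rightarrow> real) \<Rightarrow> nat \<Rightarrow> complex \<Rightarrow> real \<Rightarrow> complex" where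
  "C_hat q j l x = - ((\<i> * l) ^ j *
     (\<i> / (3 * l^2) * (LINT t|lebesgue. kern l j (x - t) * (of_real (q t) * (phi0 q l t - 1)))))"

definition D_hat :: "(real \<Rightarrow> real) \<Rightarrow> nat \<Rightarrow> complex \<Rightarrow> real \<Rightarrow> complex" where
  "D_hat q j l x = - ((\<i> * l) ^ j * (\<i> / (3 * l^2) *
     ((LINT t|lebesgue. kern l j (x - t) * of_real (q t)) - of_real (LINT t:{..x}|lebesgue. q t))))"

section \<open>Estimates and expansions at a fixed parameter\<close>

locale large_parameter =
  fixes q :: "real \<Rightarrow> real" and l :: complex
  assumes q: "integrable lebesgue q" and q2: "integrable lebesgue (\<lambda>x. (q x)\<^sup>2)"
    and l: "l \<in> Omega0_minus" and r_less_1: "rr q l < 1"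
begin

lemma l_nonzero: "l \<noteq> 0"
  using Omega0_minus_nonzero[OF l] .

lemma r_nonneg: "rr q l \<ge> 0"
  by (simp add: rr_def Lnorm_1)

lemma weighted: "\<exists>w. Volterra_weight q (norm l) w"
  using ex_Volterra_weight_locale[OF q q2] l_nonzero by simp

lemma measurable: "phi0 q l \<in> borel_measurable lebesgue"
  using weighted Volterra_weight.phi0_measurable[OF _ l] by blast

lemma tendsto: "(\<lambda>n. phi0_approx q l n x) \<longlonglongrightarrow> phi0 q l x"
  using weighted Volterra_weight.phi0_approx_tendsto[OF _ l] by blast

lemma phi0_eq:
  "phi0 q l x = 1 - \<i> / (3 * l^2) * (LINT t|lebesgue. kern l 0 (x - t) * (of_real (q t) * phi0 q l t))"
  using weighted Volterra_weight.solves_phi0_equation_phi0[OF _ l] phi0_map_eq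
  unfolding solves_phi0_equation_def by (metis order_refl)

text \<open>The bound is the fixed point of the recursion \<open>b = 1 + rr q l * b\<close>, so it
  propagates through the iteration.\<close>

lemma norm_phi0_approx_le_geometric: "norm (phi0_approx q l n x) \<le> inverse (1 - rr q l)"
proof (induction n arbitrary: x)
  case 0
  then show ?case using r_nonneg r_less_1 by (simp add: one_le_inverse)
next
  case (Suc n)
  have "norm (phi0_approx q l (Suc n) x) \<le> 1 + rr q l * inverse (1 - rr q l)"
    unfolding phi0_approx_Suc
    by (rule order_trans[OF norm_triangle_ineq4])
      (use norm_volterra_term_le_const[OF l q phi0_approx_measurable[OF l q] Suc] in \<open>simp add: rr_def Lnorm_1\<close>)
  also have "\<dots> = inverse (1 - rr q l)"
    using r_less_1 by (simp add: field_simps)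
  finally show ?case .
qed

lemma norm_phi0_le: "norm (phi0 q l x) \<le> inverse (1 - rr q l)"
  by (rule LIMSEQ_le_const2[OF tendsto_norm[OF tendsto]]) (use norm_phi0_approx_le_geometric in blast)

lemma integrable_q_phi0: "integrable lebesgue (\<lambda>t. of_real (q t) * phi0 q l t)"
  by (rule integrable_of_real_mult_bounded[OF q measurable norm_phi0_le])

lemma norm_phi0_minus_1_le: "norm (phi0 q l x - 1) \<le> rr q l * inverse (1 - rr q l)"
proof -
  have "phi0 q l x - 1
      = - (\<i> / (3 * l^2) * (LINT t|lebesgue. kern l 0 (x - t) * (of_real (q t) * phi0 q l t)))"
    by (subst phi0_eq) simp
  then have "norm (phi0 q l x - 1)
      = norm (\<i> / (3 * l^2) * (LINT t|lebesgue. kern l 0 (x - t) * (of_real (q t) * phi0 q l t)))"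
    by (simp only: norm_minus_cancel)
  also have "\<dots> \<le> rr q l * inverse (1 - rr q l)"
    using norm_volterra_term_le_const[OF l q measurable norm_phi0_le] by (simp add: rr_def Lnorm_1)
  finally show ?thesis .
qed

text \<open>One factor \<open>rr q l\<close> comes from the operator and one from
  \<open>phi0 - 1\<close>. The additional factor over the claimed bound is what yields strictness
  later.\<close>

lemma norm_C_hat_le: "norm (C_hat q j l x) \<le> norm l ^ j * (rr q l * (rr q l * inverse (1 - rr q l)))"
proof -
  have "norm (\<i> / (3 * l^2) * (LINT t|lebesgue. kern l j (x - t) * (of_real (q t) * (phi0 q l t - 1))))
      \<le> rr q l * (rr q l * inverse (1 - rr q l))"
    using norm_volterra_term_le_const[OF l q borel_measurable_diff[OF measurable borel_measurable_const] norm_phi0_minus_1_le]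
    by (simp add: rr_def Lnorm_1)
  then show ?thesis
    unfolding C_hat_def norm_minus_cancel norm_mult[of "(\<i> * l) ^ j"]
    by (simp add: norm_power norm_mult[of \<i>] mult_left_mono)
qed

text \<open>The constant \<open>2 / 3\<close> arises from two decaying exponentials over the
  \<open>3\<close> of the prefactor; being below one, it leaves room for the strict
  inequality.\<close>

lemma norm_D_hat_le: "norm (D_hat q j l x) \<le> 2 / 3 * (Lnorm 2 q * norm l powi (int j - 2) * delta_hat l)"
proof -
  define I where "I = (LINT t|lebesgue. kern l j (x - t) * of_real (q t)) - of_real (LINT t:{..x}|lebesgue. q t)"
  have "norm (D_hat q j l x) = norm l ^ j * (1 / (3 * norm l ^ 2) * norm I)"
    by (simp add: D_hat_def I_def[symmetric] norm_mult norm_divide norm_power)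
  also have "\<dots> \<le> norm l ^ j * (1 / (3 * norm l ^ 2) * (2 * (Lnorm 2 q * delta_hat l)))"
    using norm_kern_tail_integral_le[OF l q q2, of j x] by (intro mult_left_mono) (auto simp: I_def)
  also have "\<dots> = 2 / 3 * (Lnorm 2 q * (norm l ^ j / norm l ^ 2) * delta_hat l)"
    by simp
  also have "norm l ^ j / norm l ^ 2 = norm l powi (int j - 2)"
    using l_nonzero by (simp add: power_int_diff)
  finally show ?thesis .
qed

lemma jost_amplitude_expansion:
  "jost_amplitude q l j x = (\<i> * l) ^ j * (1 - \<i> / (3 * l^2) * of_real (LINT t:{..x}|lebesgue. q t))
    + C_hat q j l x + D_hat q j l x"
proof -
  have "integrable lebesgue (\<lambda>t. of_real (q t) :: complex)" using q by simp
  then have eq: "(LINT t|lebesgue. kern l j (x - t) * (of_real (q t) * (phi0 q l t - 1)))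
    = (LINT t|lebesgue. kern l j (x - t) * (of_real (q t) * phi0 q l t)) - (LINT t|lebesgue. kern l j (x - t) * of_real (q t))"
    using integrable_kern_mult[OF l] integrable_q_phi0
    by (subst Bochner_Integration.integral_diff[symmetric]) (simp_all add: right_diff_distrib)
  \<comment> \<open>The letters stand for the integral with \<open>phi0\<close> (\<open>A\<close>),
    the one with \<open>q\<close> alone (\<open>B\<close>), and the integral of \<open>q\<close> up
    to \<open>x\<close> (\<open>m\<close>).\<close>
  have "p * (1 - c * A) = p * (1 - c * m) + - (p * (c * (A - B))) + - (p * (c * (B - m)))" for p c A B m :: complex
    by (simp add: algebra_simps)
  then show ?thesis
    unfolding jost_amplitude_def C_hat_def D_hat_def eq .
qed

text \<open>Differentiating the kernel gives the difference of the integrals with indices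
  \<open>Suc j\<close> and \<open>j\<close>, and differentiating the exponential restores the one
  with index \<open>j\<close>, so that only index \<open>Suc j\<close> survives.\<close>

lemma jost_amplitude_has_vector_derivative:
  assumes "j < 2"
  shows "((\<lambda>x. jost_amplitude q l j x * exp (\<i> * l * of_real x)) has_vector_derivative
    jost_amplitude q l (Suc j) x * exp (\<i> * l * of_real x)) (at x)"
proof -
  let ?K = "\<lambda>j x. LINT t|lebesgue. kern l j (x - t) * (of_real (q t) * phi0 q l t)"
  have e: "((\<lambda>x. exp (\<i> * l * of_real x)) has_vector_derivative exp (\<i> * l * of_real x) * (\<i> * l)) (at x)"
  proof -
    have "((\<lambda>z. exp (\<i> * l * z)) has_field_derivative exp (\<i> * l * of_real x) * (\<i> * l)) (at (of_real x))"
      by (auto intro!: derivative_eq_intros)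
    then show ?thesis
      by (rule has_vector_derivative_real_field)
  qed
  have "((\<lambda>x. (\<i> * l) ^ j * (1 - \<i> / (3 * l^2) * ?K j x)) has_vector_derivative
      (\<i> * l) ^ j * (0 - \<i> / (3 * l^2) * (\<i> * l * (?K (Suc j) x - ?K j x)))) (at x)"
    by (intro has_vector_derivative_mult_right has_vector_derivative_diff has_vector_derivative_const
        kern_convolution_has_vector_derivative[OF l assms integrable_q_phi0])
  from has_vector_derivative_mult[OF this e] show ?thesis
    unfolding jost_amplitude_def
    by (rule has_vector_derivative_eq_rhs) (simp add: algebra_simps)
qed

lemma jost_amplitude_0: "jost_amplitude q l 0 x = phi0 q l x"
  unfolding jost_amplitude_def power_0 mult_1_left by (rule phi0_eq[symmetric])

lemma u0_eq: "u0 q l = (\<lambda>x. jost_amplitude q l 0 x * exp (\<i> * l * of_real x))"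
  by (rule ext) (simp add: u0_def jost_amplitude_0)

lemma u0_has_vector_derivative:
  "(u0 q l has_vector_derivative jost_amplitude q l 1 x * exp (\<i> * l * of_real x)) (at x)"
  using jost_amplitude_has_vector_derivative[of 0 x] unfolding u0_eq by simp

lemma vector_derivative_u0:
  "(\<lambda>x. vector_derivative (u0 q l) (at x)) = (\<lambda>x. jost_amplitude q l 1 x * exp (\<i> * l * of_real x))"
  using u0_has_vector_derivative by (intro ext vector_derivative_at)

lemma vector_derivative_u0_has_vector_derivative:
  "((\<lambda>x. vector_derivative (u0 q l) (at x)) has_vector_derivative
    jost_amplitude q l 2 x * exp (\<i> * l * of_real x)) (at x)"
  using jost_amplitude_has_vector_derivative[of 1 x] unfolding vector_derivative_u0
  by (simp add: numeral_2_eq_2)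

lemma expansions:
  shows "phi0 q l x =
      1 - \<i> / (3 * l^2) * complex_of_real (LINT t:{..x}|lebesgue. q t) + C_hat q 0 l x + D_hat q 0 l x"
    and "vector_derivative (u0 q l) (at x) * exp (- (\<i> * l * zeta 0 * complex_of_real x)) =
      \<i> * l * zeta 0 + 1 / (3 * l) * complex_of_real (LINT t:{..x}|lebesgue. q t) + C_hat q 1 l x + D_hat q 1 l x"
    and "vector_derivative (\<lambda>y. vector_derivative (u0 q l) (at y)) (at x)
        * exp (- (\<i> * l * zeta 0 * complex_of_real x)) =
      (\<i> * l * zeta 0)^2 + \<i> / 3 * complex_of_real (LINT t:{..x}|lebesgue. q t) + C_hat q 2 l x + D_hat q 2 l x"
proof -
  show "phi0 q l x =
      1 - \<i> / (3 * l^2) * complex_of_real (LINT t:{..x}|lebesgue. q t) + C_hat q 0 l x + D_hat q 0 l x"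
    unfolding jost_amplitude_0[symmetric] by (simp add: jost_amplitude_expansion)
  have cancel: "c * exp (\<i> * l * of_real x) * exp (- (\<i> * l * zeta 0 * of_real x)) = c" for c
    by (simp add: mult.assoc flip: exp_add)
  have "jost_amplitude q l 1 x =
      \<i> * l + 1 / (3 * l) * complex_of_real (LINT t:{..x}|lebesgue. q t) + C_hat q 1 l x + D_hat q 1 l x"
    using l_nonzero by (simp add: jost_amplitude_expansion right_diff_distrib power2_eq_square)
  then show "vector_derivative (u0 q l) (at x) * exp (- (\<i> * l * zeta 0 * complex_of_real x)) =
      \<i> * l * zeta 0 + 1 / (3 * l) * complex_of_real (LINT t:{..x}|lebesgue. q t) + C_hat q 1 l x + D_hat q 1 l x"
    unfolding vector_derivative_at[OF u0_has_vector_derivative] cancel by simp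
  have "jost_amplitude q l 2 x =
      (\<i> * l)^2 + \<i> / 3 * complex_of_real (LINT t:{..x}|lebesgue. q t) + C_hat q 2 l x + D_hat q 2 l x"
    using l_nonzero by (simp add: jost_amplitude_expansion right_diff_distrib power_mult_distrib)
  then show "vector_derivative (\<lambda>y. vector_derivative (u0 q l) (at y)) (at x)
        * exp (- (\<i> * l * zeta 0 * complex_of_real x)) =
      (\<i> * l * zeta 0)^2 + \<i> / 3 * complex_of_real (LINT t:{..x}|lebesgue. q t) + C_hat q 2 l x + D_hat q 2 l x"
    unfolding vector_derivative_at[OF vector_derivative_u0_has_vector_derivative] cancel by simp
qed

lemma C_hat_bound: "norm (C_hat q k l x) \<le> norm l ^ k * rr q l * inverse (1 - rr q l)"
proof -
  have "rr q l * (rr q l * inverse (1 - rr q l)) \<le> 1 * (rr q l * inverse (1 - rr q l))"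
    using r_nonneg r_less_1 by (intro mult_right_mono) auto
  then have "norm l ^ k * (rr q l * (rr q l * inverse (1 - rr q l))) \<le> norm l ^ k * (1 * (rr q l * inverse (1 - rr q l)))"
    by (intro mult_left_mono) auto
  then show ?thesis using norm_C_hat_le[of k x] by (simp add: mult.assoc)
qed

lemma delta_hat_pos: "delta_hat l > 0"
  using l by (simp add: delta_hat_def Omega0_minus_def mult.commute)

lemma D_hat_bound: "norm (D_hat q k l x) \<le> Lnorm 2 q * norm l powi (int k - 2) * delta_hat l"
proof -
  have "0 \<le> Lnorm 2 q * norm l powi (int k - 2) * delta_hat l"
    using delta_hat_pos by (simp add: Lnorm_2)
  then show ?thesis using norm_D_hat_le[of k x] by linarith
qed

text \<open>For a nonzero potential the claimed bounds are positive, while the proved ones are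
  smaller by the factors \<open>rr q l < 1\<close> and \<open>2 / 3\<close>.\<close>

lemma strict_bounds:
  assumes "\<not> (AE t in lebesgue. q t = 0)"
  shows "norm (C_hat q k l x) < norm l ^ k * rr q l * inverse (1 - rr q l)"
    and "norm (D_hat q k l x) < Lnorm 2 q * norm l powi (int k - 2) * delta_hat l"
proof -
  have "0 < rr q l"
    using not_AE_zero_imp_integral_abs_pos[OF q assms] l_nonzero by (simp add: rr_def Lnorm_1)
  then have "rr q l * (rr q l * inverse (1 - rr q l)) < 1 * (rr q l * inverse (1 - rr q l))"
    using r_less_1 by (intro mult_strict_right_mono) auto
  then have "norm l ^ k * (rr q l * (rr q l * inverse (1 - rr q l))) < norm l ^ k * (1 * (rr q l * inverse (1 - rr q l)))"
    using l_nonzero by (intro mult_strict_left_mono) auto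
  then show "norm (C_hat q k l x) < norm l ^ k * rr q l * inverse (1 - rr q l)"
    using norm_C_hat_le[of k x] by (simp add: mult.assoc)
  have "0 < Lnorm 2 q * norm l powi (int k - 2) * delta_hat l"
    using not_AE_zero_imp_integral_power2_pos[OF q2 assms] l_nonzero delta_hat_pos by (simp add: Lnorm_2)
  then show "norm (D_hat q k l x) < Lnorm 2 q * norm l powi (int k - 2) * delta_hat l"
    using norm_D_hat_le[of k x] by linarith
qed

end

section \<open>Holomorphy on the whole sector and the final assembly\<close>

text \<open>Each weight works only away from the origin. As \<open>0\<close> is outside the sector,
  the open sets with \<open>rho < norm l\<close> exhaust it, and holomorphy is a local
  property.\<close>

lemma phi0_holomorphic_on_Omega0_minus:
  assumes "integrable lebesgue q" "integrable lebesgue (\<lambda>x. (q x)\<^sup>2)"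
  shows "(\<lambda>l. phi0 q l x) holomorphic_on Omega0_minus"
proof -
  have "(\<lambda>l. phi0 q l x) holomorphic_on (\<Union>rho\<in>{0<..}. Omega0_minus \<inter> {l. rho < norm l})"
  proof (rule holomorphic_on_UN_open)
    fix rho :: real assume "rho \<in> {0<..}"
    then have "\<exists>w. Volterra_weight q rho w"
      using assms by (intro ex_Volterra_weight_locale) auto
    then show "(\<lambda>l. phi0 q l x) holomorphic_on (Omega0_minus \<inter> {l. rho < norm l})"
      by (rule exE) (rule Volterra_weight.phi0_holomorphic)
    show "open (Omega0_minus \<inter> {l. rho < norm l})"
      by (intro open_Int open_Omega0_minus open_Collect_less continuous_intros)
  qed
  also have "(\<Union>rho\<in>{0<..}. Omega0_minus \<inter> {l. rho < norm l}) = Omega0_minus"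
  proof (intro equalityI subsetI)
    fix l assume l: "l \<in> Omega0_minus"
    then have "norm l / 2 \<in> {0<..}" "norm l / 2 < norm l"
      using Omega0_minus_nonzero by auto
    with l show "l \<in> (\<Union>rho\<in>{0<..}. Omega0_minus \<inter> {l. rho < norm l})"
      by blast
  qed auto
  finally show ?thesis .
qed

text \<open>Because \<open>lim\<close> and \<open>vector_derivative\<close> are total, convergence
  and differentiability are asserted explicitly. If \<open>q\<close> vanishes almost everywhere, all
  bounds on the remainders are zero and strict inequality is impossible; hence the strict form is
  asserted for the other potentials and the weak form for all.\<close>

theorem theorem1p4:
  fixes a :: real and q :: "real \<Rightarrow> real"
  assumes "a > 0"
    and "q \<in> borel_measurable lebesgue"
    and "integrable lebesgue (\<lambda>x. \<bar>q x\<bar>^2 * exp (2 * a * \<bar>x\<bar>))"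
  shows
    "(\<forall>l\<in>Omega0_minus.
        (\<forall>x. (\<lambda>n. phi0_approx q l n x) \<longlonglongrightarrow> phi0 q l x) \<and>
        solves_phi0_equation q l (phi0 q l)) \<and>
     (\<forall>x. (\<lambda>l. phi0 q l x) holomorphic_on Omega0_minus) \<and>
     (\<exists>C D :: nat \<Rightarrow> complex \<Rightarrow> real \<Rightarrow> complex.
        \<forall>l\<in>Omega0_minus. rr q l < 1 \<longrightarrow> (\<forall>x.
          phi0 q l x =
            1 - \<i> / (3 * l^2) * complex_of_real (LINT t:{..x}|lebesgue. q t)
            + C 0 l x + D 0 l x \<and>
          u0 q l differentiable (at x) \<and>
          vector_derivative (u0 q l) (at x) * exp (- (\<i> * l * zeta 0 * complex_of_real x)) =
            \<i> * l * zeta 0 + 1 / (3 * l) * complex_of_real (LINT t:{..x}|lebesgue. q t)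
            + C 1 l x + D 1 l x \<and>
          (\<lambda>y. vector_derivative (u0 q l) (at y)) differentiable (at x) \<and>
          vector_derivative (\<lambda>y. vector_derivative (u0 q l) (at y)) (at x)
              * exp (- (\<i> * l * zeta 0 * complex_of_real x)) =
            (\<i> * l * zeta 0)^2 + \<i> / 3 * complex_of_real (LINT t:{..x}|lebesgue. q t)
            + C 2 l x + D 2 l x \<and>
          (\<forall>k\<le>2.
             norm (C k l x) \<le> norm l ^ k * rr q l * inverse (1 - rr q l) \<and>
             norm (D k l x) \<le> Lnorm 2 q * norm l powi (int k - 2) * delta_hat l \<and>
             (\<not> (AE t in lebesgue. q t = 0) \<longrightarrow>
                norm (C k l x) < norm l ^ k * rr q l * inverse (1 - rr q l) \<and>
                norm (D k l x) < Lnorm 2 q * norm l powi (int k - 2) * delta_hat l))))"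
proof -
  note q = integrable_of_exp_weighted_square[OF assms]
  have "(\<forall>x. (\<lambda>n. phi0_approx q l n x) \<longlonglongrightarrow> phi0 q l x) \<and> solves_phi0_equation q l (phi0 q l)"
    if l: "l \<in> Omega0_minus" for l
  proof -
    have "\<exists>w. Volterra_weight q (norm l) w"
      using ex_Volterra_weight_locale[OF q] Omega0_minus_nonzero[OF l] by simp
    then show ?thesis
      using Volterra_weight.phi0_approx_tendsto[OF _ l] Volterra_weight.solves_phi0_equation_phi0[OF _ l] by blast
  qed
  moreover have "(\<lambda>l. phi0 q l x) holomorphic_on Omega0_minus" for x
    using q by (rule phi0_holomorphic_on_Omega0_minus)
  moreover have L: "large_parameter q l" if "l \<in> Omega0_minus" "rr q l < 1" for l
    using q that by (intro large_parameter.intro)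
  ultimately show ?thesis
    by (intro conjI ballI allI exI[of _ "C_hat q"] exI[of _ "D_hat q"] impI
        large_parameter.expansions[OF L]
        differentiableI_vector[OF large_parameter.u0_has_vector_derivative[OF L]]
        differentiableI_vector[OF large_parameter.vector_derivative_u0_has_vector_derivative[OF L]]
        large_parameter.C_hat_bound[OF L] large_parameter.D_hat_bound[OF L]
        large_parameter.strict_bounds[OF L]; (assumption | blast))
qed

end
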